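(* Let $G$ be a group with a representation on a complex vector space $V$ with basis $x_1,\ldots,x_n$, let $\alpha:G\times G\to\mathbb{C}^\times$ be a normalized two-cocycle, and let $q\in\mathbb{C}^\times$. Let $g$ be a central element of $G$ such that $$g(x_1)=qx_1,\quad g(x_2)=q^{-1}x_2,\quad g(x_3)=x_3,\ \ldots,\ g(x_n)=x_n,$$ and assume that $G$ preserves the subspaces $\mathbb{C}x_1$ and $\mathbb{C}x_2$ of $V$. Let $s\in\mathbb{C}[x_3,\ldots,x_n]$ satisfy $h(s)=x_1(h)x_2(h)\alpha(g,h)\alpha^{-1}(h,g)\,s$ for all $h\in G$, and let $D_1,D_2$ be the linear operators on $A=S(V)\#_\alpha G$ defined in the context. Then $\exp_q(tD_1\otimes D_2)$ yields a formal deformation of $A$: the $\mathbb{C}[[t]]$-bilinear multiplication on $A[[t]]$ determined by $$a*b=\bigl(m\circ\exp_q(tD_1\otimes D_2)\bigr)(a\otimes b)\qquad (a,b\in A),$$ where $m:A\otimes A\to A$ is the multiplication of $A$, is a formal deformation of $A$.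
   Context: **Crossed product.** A two-cocycle is a function $\alpha:G\times G\to\mathbb{C}^\times$ with $\alpha(g,h)\alpha(gh,k)=\alpha(g,hk)\alpha(h,k)$ for all $g,h,k\in G$; normalized means $\alpha(1,g)=\alpha(g,1)=1$. $G$ acts by algebra automorphisms on the symmetric algebra $S(V)=\mathbb{C}[x_1,\ldots,x_n]$. The crossed product $S(V)\#_\alpha G$ is $S(V)\otimes\mathbb{C}G$ as a vector space, with $r\overline{g}$ denoting $r\otimes g$ and multiplication $(r\overline{g})(s\overline{h})=\alpha(g,h)\,r\,g(s)\,\overline{gh}$. **Characters.** Since $G$ preserves $\mathbb{C}x_1,\mathbb{C}x_2$, define functions $x_i:G\to\mathbb{C}^\times$ ($i=1,2$) by $h(x_i)=x_i(h)x_i$ for $h\in G$. **$q$-differentiation.** For $p\in\mathbb{C}^\times$: $(k)_p=1+p+\cdots+p^{k-1}$ for $k\ge1$, $(0)_p=0$, $(k)_p!=(k)_p\cdots(1)_p$, $(0)_p!=1$, and $\partial_{i,p}:S(V)\to S(V)$ is the linear map $\partial_{i,p}(x_1^{k_1}\cdots x_n^{k_n})=(k_i)_p\,x_1^{k_1}\cdots x_{i-1}^{k_{i-1}}x_i^{k_i-1}x_{i+1}^{k_{i+1}}\cdots x_n^{k_n}$. **Operators.** On the basis $\{x_1^{k_1}\cdots x_n^{k_n}\overline{h}\mid k_i\ge 0,\ h\in G\}$ of $S(V)\#_\alpha G$, $D_1(x_1^{k_1}\cdots x_n^{k_n}\overline{h})=x_1(h^{-1})\,\partial_{1,q}(x_1^{k_1}\cdots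 x_n^{k_n})\,\overline{h}$, $D_2(x_1^{k_1}\cdots x_n^{k_n}\overline{h})=q^{k_1}\,\partial_{2,q^{-1}}(x_1^{k_1}\cdots x_n^{k_n})\,s\,\overline{g}\cdot\overline{h}$. **The $q$-exponential.** If $q=1$ or $q$ is not a root of unity, $\exp_q(y)=\sum_{i=0}^\infty\frac{1}{(i)_q!}y^i$; if $q$ is a primitive $\ell$th root of unity with $\ell\ge2$, $\exp_q(y)=\sum_{i=0}^{\ell-1}\frac{1}{(i)_q!}y^i$. Thus $a*b=\sum_i\frac{t^i}{(i)_q!}D_1^i(a)D_2^i(b)$ with the corresponding range of $i$. **Formal deformation.** A formal deformation of a $\mathbb{C}$-algebra $A$ is an associative algebra structure on $A[[t]]$ over $\mathbb{C}[[t]]$ with multiplication $a*b=ab+\mu_1(a\otimes b)t+\mu_2(a\otimes b)t^2+\cdots$ for $a,b\in A$, where $ab$ is the product in $A$ and the $\mu_i:A\otimes A\to A$ are $\mathbb{C}$-linear maps, extended $\mathbb{C}[[t]]$-linearly.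
   Formalization: When q = 1 and s is nonzero, it is additionally assumed that G preserves the span of x_3,…,x_n; without this the multiplication is not associative (e.g. G = Z generated by h, h(x_3) = x_3 + x_1, g = 1, s = 1). For q ≠ 1 this is automatic. *)

theory Defs
  imports
    "HOL-Library.Poly_Mapping"
    "HOL-Analysis.Cartesian_Space"
    "HOL-Computational_Algebra.Formal_Power_Series"
    "HOL-Algebra.Algebraic_Closure_Type"
begin

section \<open>Algebras and formal deformations\<close>

text \<open>
  The locale \<^locale>\<open>algebra\<close> of the library only covers commutative algebras.
\<close>

definition assoc_algebra :: "'r ring \<Rightarrow> ('r, 'a) module \<Rightarrow> bool" where
  "assoc_algebra R A \<longleftrightarrow> module R A \<and> ring A \<and>
     (\<forall>c\<in>carrier R. \<forall>x\<in>carrier A. \<forall>y\<in>carrier A.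
        (c \<odot>\<^bsub>A\<^esub> x) \<otimes>\<^bsub>A\<^esub> y = c \<odot>\<^bsub>A\<^esub> (x \<otimes>\<^bsub>A\<^esub> y) \<and>
        x \<otimes>\<^bsub>A\<^esub> (c \<odot>\<^bsub>A\<^esub> y) = c \<odot>\<^bsub>A\<^esub> (x \<otimes>\<^bsub>A\<^esub> y))"

text \<open>
  Linear maps defined on the tensor square of \<open>A\<close> are represented by bilinear maps on \<open>A\<close>.
\<close>

definition bilinear_on :: "(complex, 'a) module \<Rightarrow> ('a \<Rightarrow> 'a \<Rightarrow> 'a) \<Rightarrow> bool" where
  "bilinear_on A f \<longleftrightarrow>
     (\<forall>a\<in>carrier A. \<forall>b\<in>carrier A. f a b \<in> carrier A) \<and>
     (\<forall>a\<in>carrier A. \<forall>b\<in>carrier A. \<forall>c\<in>carrier A.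
        f (a \<oplus>\<^bsub>A\<^esub> b) c = f a c \<oplus>\<^bsub>A\<^esub> f b c \<and> f a (b \<oplus>\<^bsub>A\<^esub> c) = f a b \<oplus>\<^bsub>A\<^esub> f a c) \<and>
     (\<forall>z. \<forall>a\<in>carrier A. \<forall>b\<in>carrier A.
        f (z \<odot>\<^bsub>A\<^esub> a) b = z \<odot>\<^bsub>A\<^esub> f a b \<and> f a (z \<odot>\<^bsub>A\<^esub> b) = z \<odot>\<^bsub>A\<^esub> f a b)"

text \<open>
  An element \<open>u\<close> of \<open>A[[t]]\<close> is the sequence of its coefficients.  The argument \<open>star\<close>
  sends \<open>a\<close> and \<open>b\<close> to the power series \<open>a * b\<close>, whose coefficient at \<open>t^i\<close> is
  \<open>star a b i\<close>; the multiplication of \<open>A[[t]]\<close> is its extension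
  \<open>(\<Sum>\<^sub>i u\<^sub>i t^i) * (\<Sum>\<^sub>j v\<^sub>j t^j) = \<Sum>\<^sub>i\<^sub>,\<^sub>j (u\<^sub>i * v\<^sub>j) t^(i+j)\<close>.
\<close>

definition power_series_algebra ::
    "(complex, 'a) module \<Rightarrow> ('a \<Rightarrow> 'a \<Rightarrow> nat \<Rightarrow> 'a) \<Rightarrow> (nat \<Rightarrow> 'a) \<Rightarrow> (complex fps, nat \<Rightarrow> 'a) module"
  where
  "power_series_algebra A star e =
     \<lparr> carrier = {u. \<forall>k. u k \<in> carrier A},
       monoid.mult = (\<lambda>u v k. finsum A (\<lambda>(i, j). star (u i) (v j) (k - (i + j))) {(i, j). i + j \<le> k}),
       monoid.one = e,
       ring.zero = (\<lambda>k. \<zero>\<^bsub>A\<^esub>),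
       ring.add = (\<lambda>u v k. u k \<oplus>\<^bsub>A\<^esub> v k),
       module.smult = (\<lambda>c u k. finsum A (\<lambda>i. fps_nth c i \<odot>\<^bsub>A\<^esub> u (k - i)) {..k}) \<rparr>"

definition formal_deformation ::
    "(complex, 'a) module \<Rightarrow> ('a \<Rightarrow> 'a \<Rightarrow> nat \<Rightarrow> 'a) \<Rightarrow> bool" where
  "formal_deformation A star \<longleftrightarrow>
     assoc_algebra ring_of_type_algebra A \<and>
     (\<forall>i. bilinear_on A (\<lambda>a b. star a b i)) \<and>
     (\<forall>a\<in>carrier A. \<forall>b\<in>carrier A. star a b 0 = a \<otimes>\<^bsub>A\<^esub> b) \<and>
     (\<exists>e. assoc_algebra ring_of_type_algebra (power_series_algebra A star e))"

section \<open>The symmetric algebra of a representation\<close>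

text \<open>
  \<open>V\<close> is \<open>complex ^ 'n\<close> and \<open>x\<^sub>1, \<dots>, x\<^sub>n\<close> are the vectors \<open>axis i 1\<close>, indexed by the finite
  type \<open>'n\<close>; so \<open>S(V)\<close> is the ring of polynomials with variables indexed by \<open>'n\<close>, and the
  exponent vectors of monomials have type \<open>'n \<Rightarrow>\<^sub>0 nat\<close>.
\<close>

type_synonym 'n mpoly = "('n \<Rightarrow>\<^sub>0 nat) \<Rightarrow>\<^sub>0 complex"

definition pconst :: "complex \<Rightarrow> 'n mpoly" where
  "pconst c = Poly_Mapping.single 0 c"

definition linear_form :: "complex ^ 'n \<Rightarrow> 'n::finite mpoly" where
  "linear_form v = (\<Sum>i\<in>UNIV. Poly_Mapping.single (Poly_Mapping.single i 1) (vec_nth v i))"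

text \<open>The algebra endomorphism of \<open>S(V)\<close> that extends the endomorphism of \<open>V\<close> with matrix \<open>M\<close>.\<close>

definition sym_act :: "complex ^ 'n ^ 'n \<Rightarrow> 'n::finite mpoly \<Rightarrow> 'n mpoly" where
  "sym_act M p = (\<Sum>m\<in>Poly_Mapping.keys p. pconst (Poly_Mapping.lookup p m) *
      (\<Prod>j\<in>UNIV. linear_form (M *v axis j 1) ^ Poly_Mapping.lookup m j))"

definition group_representation ::
    "('g, 'm) monoid_scheme \<Rightarrow> ('g \<Rightarrow> complex ^ 'n ^ 'n::finite) \<Rightarrow> bool" where
  "group_representation G \<rho> \<longleftrightarrow> \<rho> \<one>\<^bsub>G\<^esub> = mat 1 \<and>
     (\<forall>g\<in>carrier G. \<forall>h\<in>carrier G. \<rho> (g \<otimes>\<^bsub>G\<^esub> h) = \<rho> g ** \<rho> h)"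

definition preserves_subspace ::
    "('g, 'm) monoid_scheme \<Rightarrow> ('g \<Rightarrow> complex ^ 'n ^ 'n::finite) \<Rightarrow> (complex ^ 'n) set \<Rightarrow> bool" where
  "preserves_subspace G \<rho> W \<longleftrightarrow> (\<forall>h\<in>carrier G. \<forall>v\<in>W. \<rho> h *v v \<in> W)"

text \<open>The scalar \<open>x\<^sub>i(h)\<close> with \<open>h(x\<^sub>i) = x\<^sub>i(h) x\<^sub>i\<close>, for a preserved line spanned by \<open>x\<^sub>i\<close>.\<close>

definition line_char :: "('g \<Rightarrow> complex ^ 'n ^ 'n) \<Rightarrow> 'n::finite \<Rightarrow> 'g \<Rightarrow> complex" where
  "line_char \<rho> i h = (THE c. \<rho> h *v axis i 1 = c *s axis i 1)"

section \<open>Crossed products\<close>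

definition two_cocycle :: "('g, 'm) monoid_scheme \<Rightarrow> ('g \<Rightarrow> 'g \<Rightarrow> complex) \<Rightarrow> bool" where
  "two_cocycle G \<alpha> \<longleftrightarrow>
     (\<forall>g\<in>carrier G. \<forall>h\<in>carrier G. \<alpha> g h \<noteq> 0) \<and>
     (\<forall>g\<in>carrier G. \<forall>h\<in>carrier G. \<forall>k\<in>carrier G.
        \<alpha> g h * \<alpha> (g \<otimes>\<^bsub>G\<^esub> h) k = \<alpha> g (h \<otimes>\<^bsub>G\<^esub> k) * \<alpha> h k)"

definition normalized_cocycle :: "('g, 'm) monoid_scheme \<Rightarrow> ('g \<Rightarrow> 'g \<Rightarrow> complex) \<Rightarrow> bool" where
  "normalized_cocycle G \<alpha> \<longleftrightarrow> (\<forall>g\<in>carrier G. \<alpha> \<one>\<^bsub>G\<^esub> g = 1 \<and> \<alpha> g \<one>\<^bsub>G\<^esub> = 1)"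

text \<open>
  The element of the crossed product that is the sum of the \<open>r\<^sub>h h\<close> (\<open>h\<close> in \<open>G\<close>, \<open>r\<^sub>h\<close> in
  \<open>S(V)\<close>) is the finitely supported function sending \<open>h\<close> to \<open>r\<^sub>h\<close>; in particular \<open>r h\<close> is
  \<open>Poly_Mapping.single h r\<close>.
\<close>

definition cp_scale :: "complex \<Rightarrow> ('g \<Rightarrow>\<^sub>0 'n mpoly) \<Rightarrow> ('g \<Rightarrow>\<^sub>0 'n mpoly)" where
  "cp_scale c a = Poly_Mapping.map (\<lambda>r. pconst c * r) a"

definition crossed_product ::
    "('g, 'm) monoid_scheme \<Rightarrow> ('g \<Rightarrow> complex ^ 'n ^ 'n) \<Rightarrow> ('g \<Rightarrow> 'g \<Rightarrow> complex) \<Rightarrow>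
     (complex, 'g \<Rightarrow>\<^sub>0 'n::finite mpoly) module" where
  "crossed_product G \<rho> \<alpha> =
     \<lparr> carrier = {a. Poly_Mapping.keys a \<subseteq> carrier G},
       monoid.mult = (\<lambda>a b. \<Sum>g\<in>Poly_Mapping.keys a. \<Sum>h\<in>Poly_Mapping.keys b.
          Poly_Mapping.single (g \<otimes>\<^bsub>G\<^esub> h)
            (pconst (\<alpha> g h) * Poly_Mapping.lookup a g * sym_act (\<rho> g) (Poly_Mapping.lookup b h))),
       monoid.one = Poly_Mapping.single \<one>\<^bsub>G\<^esub> 1,
       ring.zero = 0,
       ring.add = (+),
       module.smult = cp_scale \<rparr>"

text \<open>
  The linear extension of a map given on the basis elements \<open>x^m h\<close>, with \<open>m\<close> an exponent
  vector.
\<close>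

definition cp_extend ::
    "(('n \<Rightarrow>\<^sub>0 nat) \<Rightarrow> 'g \<Rightarrow> 'g \<Rightarrow>\<^sub>0 'n mpoly) \<Rightarrow> ('g \<Rightarrow>\<^sub>0 'n mpoly) \<Rightarrow> ('g \<Rightarrow>\<^sub>0 'n mpoly)" where
  "cp_extend f a = (\<Sum>h\<in>Poly_Mapping.keys a. \<Sum>m\<in>Poly_Mapping.keys (Poly_Mapping.lookup a h).
      cp_scale (Poly_Mapping.lookup (Poly_Mapping.lookup a h) m) (f m h))"

section \<open>\<open>q\<close>-differentiation and the \<open>q\<close>-exponential\<close>

definition qnum :: "complex \<Rightarrow> nat \<Rightarrow> complex" where
  "qnum p k = (\<Sum>j<k. p ^ j)"

definition qfact :: "complex \<Rightarrow> nat \<Rightarrow> complex" where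
  "qfact p k = (\<Prod>j = 1..k. qnum p j)"

text \<open>
  For exponent \<open>0\<close> the truncated subtraction below is harmless, since \<open>qnum p 0 = 0\<close>.
\<close>

definition qdiff :: "'n \<Rightarrow> complex \<Rightarrow> 'n mpoly \<Rightarrow> 'n mpoly" where
  "qdiff i p r = (\<Sum>m\<in>Poly_Mapping.keys r.
      Poly_Mapping.single (m - Poly_Mapping.single i 1)
        (qnum p (Poly_Mapping.lookup m i) * Poly_Mapping.lookup r m))"

definition primitive_root_of_unity :: "nat \<Rightarrow> complex \<Rightarrow> bool" where
  "primitive_root_of_unity l p \<longleftrightarrow> 0 < l \<and> p ^ l = 1 \<and> (\<forall>k. 0 < k \<and> k < l \<longrightarrow> p ^ k \<noteq> 1)"

definition qexp :: "complex \<Rightarrow> complex fps" where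
  "qexp p = Abs_fps (\<lambda>i. if \<exists>l\<ge>2. primitive_root_of_unity l p \<and> l \<le> i then 0 else 1 / qfact p i)"

text \<open>
  The image of the tensor \<open>a \<otimes> b\<close> under \<open>m \<circ> exp\<^sub>p (t D1 \<otimes> D2)\<close>, as a sequence of coefficients.
\<close>

definition qexp_star ::
    "(complex, 'a) module \<Rightarrow> complex \<Rightarrow> ('a \<Rightarrow> 'a) \<Rightarrow> ('a \<Rightarrow> 'a) \<Rightarrow> 'a \<Rightarrow> 'a \<Rightarrow> nat \<Rightarrow> 'a" where
  "qexp_star A p D1 D2 a b i =
     fps_nth (qexp p) i \<odot>\<^bsub>A\<^esub> ((D1 ^^ i) a \<otimes>\<^bsub>A\<^esub> (D2 ^^ i) b)"

section \<open>The operators\<close>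

text \<open>
  The indices \<open>i1\<close> and \<open>i2\<close> stand for \<open>1\<close> and \<open>2\<close>.
\<close>

definition op_D1 ::
    "('g, 'm) monoid_scheme \<Rightarrow> ('g \<Rightarrow> complex ^ 'n ^ 'n) \<Rightarrow> 'n::finite \<Rightarrow> complex \<Rightarrow>
     ('g \<Rightarrow>\<^sub>0 'n mpoly) \<Rightarrow> ('g \<Rightarrow>\<^sub>0 'n mpoly)" where
  "op_D1 G \<rho> i1 q = cp_extend (\<lambda>m h.
     Poly_Mapping.single h
       (pconst (line_char \<rho> i1 (inv\<^bsub>G\<^esub> h)) * qdiff i1 q (Poly_Mapping.single m 1)))"

definition op_D2 ::
    "('g, 'm) monoid_scheme \<Rightarrow> ('g \<Rightarrow> complex ^ 'n ^ 'n) \<Rightarrow> ('g \<Rightarrow> 'g \<Rightarrow> complex) \<Rightarrow>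
     'n::finite \<Rightarrow> 'n \<Rightarrow> complex \<Rightarrow> 'n mpoly \<Rightarrow> 'g \<Rightarrow>
     ('g \<Rightarrow>\<^sub>0 'n mpoly) \<Rightarrow> ('g \<Rightarrow>\<^sub>0 'n mpoly)" where
  "op_D2 G \<rho> \<alpha> i1 i2 q s g = cp_extend (\<lambda>m h.
     Poly_Mapping.single g
       (pconst (q ^ Poly_Mapping.lookup m i1) *
        qdiff i2 (inverse q) (Poly_Mapping.single m 1) * s)
     \<otimes>\<^bsub>crossed_product G \<rho> \<alpha>\<^esub> Poly_Mapping.single h 1)"

end

theory Submission
  imports Defs
begin

text \<open>
  Let \<open>\<tau>\<close> scale \<open>x\<^sub>1\<close> by \<open>q\<close> and let \<open>\<sigma>(r h) = x\<^sub>1(h\<inverse>) \<tau>(r) h\<close>.  Then \<open>D\<^sub>1\<close> and \<open>D\<^sub>2\<close> are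
  commuting skew derivations,
  \<open>D\<^sub>1(ab) = D\<^sub>1(a) \<sigma>(b) + a D\<^sub>1(b)\<close> and \<open>D\<^sub>2(ab) = D\<^sub>2(a) b + \<sigma>(a) D\<^sub>2(b)\<close>,
  which \<open>q\<close>-commute with \<open>\<sigma>\<close>.  For \<open>D\<^sub>2\<close> this uses that \<open>g\<close> scales \<open>x\<^sub>2\<close> by \<open>q\<inverse>\<close> and \<open>x\<^sub>1\<close> by \<open>q\<close>, and
  the transformation rule of \<open>s\<close> compensates both the characters and the cocycle.  By the
  \<open>q\<close>-binomial theorem both \<open>(a * b) * c\<close> and \<open>a * (b * c)\<close> are sums of the terms
  \<open>D\<^sub>1\<^sup>i\<^sup>+\<^sup>k(a) \<sigma>\<^sup>k(D\<^sub>1\<^sup>l(D\<^sub>2\<^sup>i(b))) D\<^sub>2\<^sup>k\<^sup>+\<^sup>l(c)\<close>, divided by the \<open>q\<close>-factorials of \<open>i\<close>, \<open>k\<close> and \<open>l\<close>.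
  If \<open>q\<close> is a primitive root of unity of order \<open>l \<ge> 2\<close>, then \<open>D\<^sub>1\<^sup>l = D\<^sub>2\<^sup>l = 0\<close>, so that truncating the
  exponential loses nothing.
\<close>

section \<open>Power series over an associative algebra\<close>

text \<open>Identifying the ring operations with those of the type makes ordinary \<open>sum\<close>
  available in place of \<open>finsum\<close>, whose rules carry closure conditions at every
  step.\<close>

locale additive_algebra =
  fixes A :: "(complex, 'a::ab_group_add) module" (structure)
  assumes assoc_algebra: "assoc_algebra ring_of_type_algebra A"
    and add_eq: "x \<oplus> y = x + y"
    and zero_eq: "\<zero> = 0"
begin

sublocale ring A
  using assoc_algebra by (simp add: assoc_algebra_def)

lemma module_complex: "module (ring_of_type_algebra :: complex ring) A"
  using assoc_algebra by (simp add: assoc_algebra_def)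

lemma zero_carrier [simp]: "0 \<in> carrier A"
  using zero_closed by (simp add: zero_eq)

lemma add_carrier [simp]: "x \<in> carrier A \<Longrightarrow> y \<in> carrier A \<Longrightarrow> x + y \<in> carrier A"
  using a_closed by (simp add: add_eq)

lemma uminus_carrier [simp]:
  assumes "x \<in> carrier A" shows "- x \<in> carrier A"
proof -
  have "x + (\<ominus> x) = 0" using r_neg[OF assms] by (simp add: add_eq zero_eq)
  hence "\<ominus> x = - x" by (simp add: eq_neg_iff_add_eq_0 add.commute)
  thus ?thesis using a_inv_closed[OF assms] by simp
qed

lemma sum_carrier [simp]:
  "(\<And>i. i \<in> I \<Longrightarrow> f i \<in> carrier A) \<Longrightarrow> sum f I \<in> carrier A"
  by (induction I rule: infinite_finite_induct) auto

lemma finsum_eq_sum: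
  assumes "\<And>i. i \<in> I \<Longrightarrow> f i \<in> carrier A"
  shows "finsum A f I = sum f I"
  using assms
proof (induction I rule: infinite_finite_induct)
  case (insert x I)
  have "finsum A f (insert x I) = f x \<oplus> finsum A f I"
    using insert by (intro finsum_insert) auto
  thus ?case using insert by (simp add: add_eq)
qed (auto simp: finsum_infinite zero_eq)

lemma smult_carrier [simp]: "x \<in> carrier A \<Longrightarrow> c \<odot> x \<in> carrier A"
  using module.smult_closed[OF module_complex] by (simp add: ring_of_type_algebra_def)

lemma smult_add_left: "x \<in> carrier A \<Longrightarrow> (c + d) \<odot> x = c \<odot> x + d \<odot> x"
  using module.smult_l_distr[OF module_complex, of c d x]
  by (simp add: ring_of_type_algebra_def add_eq)

lemma smult_add_right:
  "x \<in> carrier A \<Longrightarrow> y \<in> carrier A \<Longrightarrow> c \<odot> (x + y) = c \<odot> x + c \<odot> y"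
  using module.smult_r_distr[OF module_complex, of c x y]
  by (simp add: ring_of_type_algebra_def add_eq)

lemma smult_smult: "x \<in> carrier A \<Longrightarrow> c \<odot> (d \<odot> x) = (c * d) \<odot> x"
  using module.smult_assoc1[OF module_complex, of c d x] by (simp add: ring_of_type_algebra_def)

lemma smult_one_left [simp]: "x \<in> carrier A \<Longrightarrow> 1 \<odot> x = x"
  using module.smult_one[OF module_complex, of x] by (simp add: ring_of_type_algebra_def)

lemma smult_zero_left [simp]: "x \<in> carrier A \<Longrightarrow> 0 \<odot> x = 0"
  using smult_add_left[of x 0 0] by simp

lemma smult_zero_right [simp]: "c \<odot> 0 = 0"
  using smult_add_right[of 0 0 c] by simp

lemma smult_sum_right:
  "(\<And>i. i \<in> I \<Longrightarrow> f i \<in> carrier A) \<Longrightarrow> c \<odot> sum f I = (\<Sum>i\<in>I. c \<odot> f i)"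
  by (induction I rule: infinite_finite_induct) (auto simp: smult_add_right)

lemma smult_sum_left:
  "x \<in> carrier A \<Longrightarrow> (\<Sum>i\<in>I. f i) \<odot> x = (\<Sum>i\<in>I. f i \<odot> x)"
  by (induction I rule: infinite_finite_induct) (auto simp: smult_add_left)

lemma mult_smult_left:
  "x \<in> carrier A \<Longrightarrow> y \<in> carrier A \<Longrightarrow> (c \<odot> x) \<otimes> y = c \<odot> (x \<otimes> y)"
  using assoc_algebra by (auto simp: assoc_algebra_def ring_of_type_algebra_def)

lemma mult_smult_right:
  "x \<in> carrier A \<Longrightarrow> y \<in> carrier A \<Longrightarrow> x \<otimes> (c \<odot> y) = c \<odot> (x \<otimes> y)"
  using assoc_algebra by (auto simp: assoc_algebra_def ring_of_type_algebra_def)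

lemma mult_add_left:
  "x \<in> carrier A \<Longrightarrow> y \<in> carrier A \<Longrightarrow> z \<in> carrier A \<Longrightarrow> (x + y) \<otimes> z = x \<otimes> z + y \<otimes> z"
  using l_distr by (simp add: add_eq)

lemma mult_add_right:
  "x \<in> carrier A \<Longrightarrow> y \<in> carrier A \<Longrightarrow> z \<in> carrier A \<Longrightarrow> z \<otimes> (x + y) = z \<otimes> x + z \<otimes> y"
  using r_distr by (simp add: add_eq)

lemma mult_zero_left [simp]: "x \<in> carrier A \<Longrightarrow> 0 \<otimes> x = 0"
  using l_null by (simp add: zero_eq)

lemma mult_zero_right [simp]: "x \<in> carrier A \<Longrightarrow> x \<otimes> 0 = 0"
  using r_null by (simp add: zero_eq)

lemma mult_sum_left:
  "(\<And>i. i \<in> I \<Longrightarrow> f i \<in> carrier A) \<Longrightarrow> y \<in> carrier A \<Longrightarrow> sum f I \<otimes> y = (\<Sum>i\<in>I. f i \<otimes> y)"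
  by (induction I rule: infinite_finite_induct) (auto simp: mult_add_left)

lemma mult_sum_right:
  "(\<And>i. i \<in> I \<Longrightarrow> f i \<in> carrier A) \<Longrightarrow> y \<in> carrier A \<Longrightarrow> y \<otimes> sum f I = (\<Sum>i\<in>I. y \<otimes> f i)"
  by (induction I rule: infinite_finite_induct) (auto simp: mult_add_right)

end

text \<open>\<open>star_assoc\<close> is associativity on elements of A, compared at
  \<open>t^n\<close>. The last two conditions say that products with the unit of A have no
  higher-order terms, so that it remains the unit in A[[t]].\<close>

locale associative_star = additive_algebra +
  fixes star :: "'a \<Rightarrow> 'a \<Rightarrow> nat \<Rightarrow> 'a"
  assumes star_bilinear: "bilinear_on A (\<lambda>a b. star a b i)"
    and star_0: "a \<in> carrier A \<Longrightarrow> b \<in> carrier A \<Longrightarrow> star a b 0 = a \<otimes> b"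
    and star_assoc: "a \<in> carrier A \<Longrightarrow> b \<in> carrier A \<Longrightarrow> c \<in> carrier A \<Longrightarrow>
      (\<Sum>i\<le>n. star (star a b i) c (n - i)) = (\<Sum>i\<le>n. star a (star b c i) (n - i))"
    and star_one_left: "a \<in> carrier A \<Longrightarrow> n > 0 \<Longrightarrow> star \<one> a n = 0"
    and star_one_right: "a \<in> carrier A \<Longrightarrow> n > 0 \<Longrightarrow> star a \<one> n = 0"
begin

lemma star_carrier [simp]:
  "a \<in> carrier A \<Longrightarrow> b \<in> carrier A \<Longrightarrow> star a b i \<in> carrier A"
  using star_bilinear by (auto simp: bilinear_on_def)

lemma star_add_left:
  "a \<in> carrier A \<Longrightarrow> b \<in> carrier A \<Longrightarrow> c \<in> carrier A \<Longrightarrow>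
     star (a + b) c i = star a c i + star b c i"
  using star_bilinear[of i] by (auto simp: bilinear_on_def add_eq)

lemma star_add_right:
  "a \<in> carrier A \<Longrightarrow> b \<in> carrier A \<Longrightarrow> c \<in> carrier A \<Longrightarrow>
     star a (b + c) i = star a b i + star a c i"
  using star_bilinear[of i] by (auto simp: bilinear_on_def add_eq)

lemma star_smult:
  "a \<in> carrier A \<Longrightarrow> b \<in> carrier A \<Longrightarrow> star (z \<odot> a) b i = z \<odot> star a b i"
  "a \<in> carrier A \<Longrightarrow> b \<in> carrier A \<Longrightarrow> star a (z \<odot> b) i = z \<odot> star a b i"
  using star_bilinear[of i] by (auto simp: bilinear_on_def)

lemma star_zero [simp]:
  "a \<in> carrier A \<Longrightarrow> star 0 a i = 0" "a \<in> carrier A \<Longrightarrow> star a 0 i = 0"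
  using star_add_left[of 0 0 a i] star_add_right[of a 0 0 i] by auto

lemma star_sum_left:
  "(\<And>i. i \<in> I \<Longrightarrow> f i \<in> carrier A) \<Longrightarrow> y \<in> carrier A \<Longrightarrow>
     star (sum f I) y n = (\<Sum>i\<in>I. star (f i) y n)"
  by (induction I rule: infinite_finite_induct) (auto simp: star_add_left)

lemma star_sum_right:
  "(\<And>i. i \<in> I \<Longrightarrow> f i \<in> carrier A) \<Longrightarrow> y \<in> carrier A \<Longrightarrow>
     star y (sum f I) n = (\<Sum>i\<in>I. star y (f i) n)"
  by (induction I rule: infinite_finite_induct) (auto simp: star_add_right)

section \<open>The algebra structure on A[[t]]\<close>

definition series_one :: "nat \<Rightarrow> 'a" where
  "series_one = (\<lambda>k. if k = 0 then \<one> else 0)"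

definition triangle :: "nat \<Rightarrow> (nat \<times> nat) set" where
  "triangle k = {(i, j). i + j \<le> k}"

lemma finite_triangle [simp]: "finite (triangle k)"
  by (rule finite_subset[of _ "{..k} \<times> {..k}"]) (auto simp: triangle_def)

abbreviation "P \<equiv> power_series_algebra A star series_one"

lemma series_carrier: "u \<in> carrier P \<longleftrightarrow> (\<forall>k. u k \<in> carrier A)"
  by (simp add: power_series_algebra_def)

lemma series_add: "u \<oplus>\<^bsub>P\<^esub> v = (\<lambda>k. u k + v k)"
  by (simp add: power_series_algebra_def add_eq)

lemma series_zero: "\<zero>\<^bsub>P\<^esub> = (\<lambda>k. 0)"
  by (simp add: power_series_algebra_def zero_eq)

lemma series_one: "\<one>\<^bsub>P\<^esub> = series_one"
  by (simp add: power_series_algebra_def)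

lemma series_mult:
  assumes "\<And>k. u k \<in> carrier A" "\<And>k. v k \<in> carrier A"
  shows "(u \<otimes>\<^bsub>P\<^esub> v) k = (\<Sum>(i, j)\<in>triangle k. star (u i) (v j) (k - (i + j)))"
  using assms unfolding power_series_algebra_def triangle_def
  by (simp, subst finsum_eq_sum) (auto simp: split_beta)

lemma series_smult:
  assumes "\<And>k. u k \<in> carrier A"
  shows "(c \<odot>\<^bsub>P\<^esub> u) k = (\<Sum>i\<le>k. fps_nth c i \<odot> u (k - i))"
  using assms unfolding power_series_algebra_def
  by (simp, subst finsum_eq_sum) auto

lemma series_mult_carrier:
  assumes "\<And>k. u k \<in> carrier A" "\<And>k. v k \<in> carrier A"
  shows "(u \<otimes>\<^bsub>P\<^esub> v) k \<in> carrier A"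
  using assms by (auto simp: series_mult intro!: sum_carrier)

text \<open>Both products are regrouped over triples of indices of \<open>u\<close>,
  \<open>v\<close> and \<open>w\<close>. For a fixed triple the remaining power of t, namely
  \<open>k - (i + j + c)\<close>, is shared between two star products, which is exactly the sum in
  \<open>star_assoc\<close>.\<close>

lemma series_mult_assoc:
  assumes u: "\<And>k. u k \<in> carrier A" and v: "\<And>k. v k \<in> carrier A" and w: "\<And>k. w k \<in> carrier A"
  shows "(u \<otimes>\<^bsub>P\<^esub> v) \<otimes>\<^bsub>P\<^esub> w = u \<otimes>\<^bsub>P\<^esub> (v \<otimes>\<^bsub>P\<^esub> w)"
proof
  fix k :: nat
  define Q where "Q = {(i, j, c). i + j + c \<le> k}"
  have finQ: "finite Q"
    by (rule finite_subset[of _ "{..k} \<times> {..k} \<times> {..k}"]) (auto simp: Q_def)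
  have "((u \<otimes>\<^bsub>P\<^esub> v) \<otimes>\<^bsub>P\<^esub> w) k =
      (\<Sum>(a, c)\<in>triangle k. star ((u \<otimes>\<^bsub>P\<^esub> v) a) (w c) (k - (a + c)))"
    using u v w by (intro series_mult series_mult_carrier)
  also have "\<dots> = (\<Sum>(a, c)\<in>triangle k. \<Sum>(i, j)\<in>triangle a.
      star (star (u i) (v j) (a - (i + j))) (w c) (k - (a + c)))"
    using u v w by (auto intro!: sum.cong simp: series_mult star_sum_left split_beta)
  also have "\<dots> = (\<Sum>((a, c), i, j)\<in>Sigma (triangle k) (\<lambda>(a, c). triangle a).
      star (star (u i) (v j) (a - (i + j))) (w c) (k - (a + c)))"
    by (simp add: sum.Sigma case_prod_unfold)
  \<comment> \<open>The new index \<open>n\<close> is the power of t contributed by the inner star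
    product, so \<open>a = i + j + n\<close>.\<close>
  also have "\<dots> = (\<Sum>((i, j, c), n)\<in>Sigma Q (\<lambda>(i, j, c). {..k - (i + j + c)}).
      star (star (u i) (v j) n) (w c) (k - (i + j + c) - n))"
    by (rule sum.reindex_bij_witness[where
          i = "\<lambda>((i, j, c), n). ((i + j + n, c), i, j)" and
          j = "\<lambda>((a, c), i, j). ((i, j, c), a - (i + j))"])
       (auto simp: triangle_def Q_def algebra_simps)
  also have "\<dots> = (\<Sum>(i, j, c)\<in>Q. \<Sum>n\<le>k - (i + j + c).
      star (star (u i) (v j) n) (w c) (k - (i + j + c) - n))"
    using finQ by (simp add: sum.Sigma case_prod_unfold)
  also have "\<dots> = (\<Sum>(i, j, c)\<in>Q. \<Sum>n\<le>k - (i + j + c).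
      star (u i) (star (v j) (w c) n) (k - (i + j + c) - n))"
    by (rule sum.cong[OF refl], clarify, rule star_assoc[OF u v w])
  also have "\<dots> = (\<Sum>((i, j, c), n)\<in>Sigma Q (\<lambda>(i, j, c). {..k - (i + j + c)}).
      star (u i) (star (v j) (w c) n) (k - (i + j + c) - n))"
    using finQ by (simp add: sum.Sigma case_prod_unfold)
  also have "\<dots> = (\<Sum>((i, a), j, c)\<in>Sigma (triangle k) (\<lambda>(i, a). triangle a).
      star (u i) (star (v j) (w c) (a - (j + c))) (k - (i + a)))"
    by (rule sum.reindex_bij_witness[where
          j = "\<lambda>((i, j, c), n). ((i, j + c + n), j, c)" and
          i = "\<lambda>((i, a), j, c). ((i, j, c), a - (j + c))"])
       (auto simp: triangle_def Q_def algebra_simps)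
  also have "\<dots> = (\<Sum>(i, a)\<in>triangle k. \<Sum>(j, c)\<in>triangle a.
      star (u i) (star (v j) (w c) (a - (j + c))) (k - (i + a)))"
    by (simp add: sum.Sigma case_prod_unfold)
  also have "\<dots> = (\<Sum>(i, a)\<in>triangle k. star (u i) ((v \<otimes>\<^bsub>P\<^esub> w) a) (k - (i + a)))"
    using u v w by (auto intro!: sum.cong simp: series_mult star_sum_right split_beta)
  also have "\<dots> = (u \<otimes>\<^bsub>P\<^esub> (v \<otimes>\<^bsub>P\<^esub> w)) k"
    using u v w by (intro series_mult[symmetric] series_mult_carrier)
  finally show "((u \<otimes>\<^bsub>P\<^esub> v) \<otimes>\<^bsub>P\<^esub> w) k = (u \<otimes>\<^bsub>P\<^esub> (v \<otimes>\<^bsub>P\<^esub> w)) k" .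
qed

text \<open>One pair of the triangle survives: other pairs either meet a zero coefficient of
  \<open>series_one\<close> or involve a star product with the unit in positive order.\<close>

lemma series_one_mult:
  assumes u: "\<And>k. u k \<in> carrier A"
  shows "series_one \<otimes>\<^bsub>P\<^esub> u = u" "u \<otimes>\<^bsub>P\<^esub> series_one = u"
proof -
  have one: "series_one k \<in> carrier A" for k by (simp add: series_one_def)
  have "(\<Sum>(i, j)\<in>triangle k. star (series_one i) (u j) (k - (i + j))) =
      (\<Sum>(i, j)\<in>{(0, k)}. star (series_one i) (u j) (k - (i + j)))" for k
  proof (intro sum.mono_neutral_right finite_triangle ballI)
    fix x assume "x \<in> triangle k - {(0, k)}"
    then obtain i j where x: "x = (i, j)" "i = 0 \<longrightarrow> j < k"
      by (cases x) (auto simp: triangle_def)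
    show "(case x of (i, j) \<Rightarrow> star (series_one i) (u j) (k - (i + j))) = 0"
      using x u by (cases "i = 0") (auto simp: series_one_def star_one_left)
  qed (auto simp: triangle_def)
  thus "series_one \<otimes>\<^bsub>P\<^esub> u = u"
    using u one by (intro ext) (simp add: series_mult, simp add: series_one_def star_0)
  have "(\<Sum>(i, j)\<in>triangle k. star (u i) (series_one j) (k - (i + j))) =
      (\<Sum>(i, j)\<in>{(k, 0)}. star (u i) (series_one j) (k - (i + j)))" for k
  proof (intro sum.mono_neutral_right finite_triangle ballI)
    fix x assume "x \<in> triangle k - {(k, 0)}"
    then obtain i j where x: "x = (i, j)" "j = 0 \<longrightarrow> i < k"
      by (cases x) (auto simp: triangle_def)
    show "(case x of (i, j) \<Rightarrow> star (u i) (series_one j) (k - (i + j))) = 0"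
      using x u by (cases "j = 0") (auto simp: series_one_def star_one_right)
  qed (auto simp: triangle_def)
  thus "u \<otimes>\<^bsub>P\<^esub> series_one = u"
    using u one by (intro ext) (simp add: series_mult, simp add: series_one_def star_0)
qed

lemma series_abelian_group: "abelian_group P"
proof (rule abelian_groupI)
  show "\<exists>y\<in>carrier P. y \<oplus>\<^bsub>P\<^esub> x = \<zero>\<^bsub>P\<^esub>" if "x \<in> carrier P" for x
    using that by (intro bexI[of _ "\<lambda>k. - x k"]) (auto simp: series_carrier series_add series_zero)
qed (auto simp: series_carrier series_add series_zero algebra_simps)

lemma series_ring: "ring P"
proof (rule ringI)
  show "Group.monoid P"
    by (rule Group.monoidI)
      (auto simp: series_carrier series_one series_mult_carrier series_mult_assoc series_one_mult,
       simp add: series_one_def)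
  show "(x \<oplus>\<^bsub>P\<^esub> y) \<otimes>\<^bsub>P\<^esub> z = x \<otimes>\<^bsub>P\<^esub> z \<oplus>\<^bsub>P\<^esub> y \<otimes>\<^bsub>P\<^esub> z"
    if "x \<in> carrier P" "y \<in> carrier P" "z \<in> carrier P" for x y z
    using that
    by (auto simp: series_carrier series_add series_mult star_add_left fun_eq_iff split_beta
        sum.distrib)
  show "z \<otimes>\<^bsub>P\<^esub> (x \<oplus>\<^bsub>P\<^esub> y) = z \<otimes>\<^bsub>P\<^esub> x \<oplus>\<^bsub>P\<^esub> z \<otimes>\<^bsub>P\<^esub> y"
    if "x \<in> carrier P" "y \<in> carrier P" "z \<in> carrier P" for x y z
    using that
    by (auto simp: series_carrier series_add series_mult star_add_right fun_eq_iff split_beta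
        sum.distrib)
qed (rule series_abelian_group)

lemma series_smult_smult:
  assumes u: "\<And>k. u k \<in> carrier A"
  shows "(c * d) \<odot>\<^bsub>P\<^esub> u = c \<odot>\<^bsub>P\<^esub> (d \<odot>\<^bsub>P\<^esub> u)"
proof
  fix k :: nat
  have "((c * d) \<odot>\<^bsub>P\<^esub> u) k =
      (\<Sum>i\<le>k. \<Sum>j\<le>i. (fps_nth c j * fps_nth d (i - j)) \<odot> u (k - i))"
    using u by (simp add: series_smult fps_mult_nth smult_sum_left atLeast0AtMost)
  also have "\<dots> = (\<Sum>(i, j)\<in>Sigma {..k} (\<lambda>i. {..i}). (fps_nth c j * fps_nth d (i - j)) \<odot> u (k - i))"
    by (simp add: sum.Sigma)
  also have "\<dots> = (\<Sum>(j, l)\<in>Sigma {..k} (\<lambda>j. {..k - j}). (fps_nth c j * fps_nth d l) \<odot> u (k - j - l))"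
    by (rule sum.reindex_bij_witness[where i = "\<lambda>(j, l). (j + l, j)" and j = "\<lambda>(i, j). (j, i - j)"])
      auto
  also have "\<dots> = (\<Sum>j\<le>k. \<Sum>l\<le>k - j. (fps_nth c j * fps_nth d l) \<odot> u (k - j - l))"
    by (simp add: sum.Sigma)
  also have "\<dots> = (c \<odot>\<^bsub>P\<^esub> (d \<odot>\<^bsub>P\<^esub> u)) k"
    using u by (simp add: series_smult smult_sum_right smult_smult)
  finally show "((c * d) \<odot>\<^bsub>P\<^esub> u) k = (c \<odot>\<^bsub>P\<^esub> (d \<odot>\<^bsub>P\<^esub> u)) k" .
qed

lemma series_smult_mult_left:
  assumes u: "\<And>k. u k \<in> carrier A" and v: "\<And>k. v k \<in> carrier A"
  shows "(c \<odot>\<^bsub>P\<^esub> u) \<otimes>\<^bsub>P\<^esub> v = c \<odot>\<^bsub>P\<^esub> (u \<otimes>\<^bsub>P\<^esub> v)"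
proof
  fix k :: nat
  have "((c \<odot>\<^bsub>P\<^esub> u) \<otimes>\<^bsub>P\<^esub> v) k =
      (\<Sum>(i, j)\<in>triangle k. \<Sum>l\<le>i. fps_nth c l \<odot> star (u (i - l)) (v j) (k - (i + j)))"
    using u v by (auto intro!: sum.cong
        simp: series_mult series_smult star_sum_left star_smult)
  also have "\<dots> = (\<Sum>((i, j), l)\<in>Sigma (triangle k) (\<lambda>(i, j). {..i}).
      fps_nth c l \<odot> star (u (i - l)) (v j) (k - (i + j)))"
    by (simp add: sum.Sigma case_prod_unfold)
  also have "\<dots> = (\<Sum>(l, i, j)\<in>Sigma {..k} (\<lambda>l. triangle (k - l)).
      fps_nth c l \<odot> star (u i) (v j) (k - l - (i + j)))"
    by (rule sum.reindex_bij_witness[where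
          i = "\<lambda>(l, i, j). ((i + l, j), l)" and j = "\<lambda>((i, j), l). (l, i - l, j)"])
      (auto simp: triangle_def algebra_simps)
  also have "\<dots> = (\<Sum>l\<le>k. \<Sum>(i, j)\<in>triangle (k - l).
      fps_nth c l \<odot> star (u i) (v j) (k - l - (i + j)))"
    by (simp add: sum.Sigma case_prod_unfold)
  also have "\<dots> = (c \<odot>\<^bsub>P\<^esub> (u \<otimes>\<^bsub>P\<^esub> v)) k"
    using u v by (simp add: series_smult series_mult_carrier series_mult smult_sum_right split_beta)
  finally show "((c \<odot>\<^bsub>P\<^esub> u) \<otimes>\<^bsub>P\<^esub> v) k = (c \<odot>\<^bsub>P\<^esub> (u \<otimes>\<^bsub>P\<^esub> v)) k" .
qed

lemma series_smult_mult_right: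
  assumes u: "\<And>k. u k \<in> carrier A" and v: "\<And>k. v k \<in> carrier A"
  shows "u \<otimes>\<^bsub>P\<^esub> (c \<odot>\<^bsub>P\<^esub> v) = c \<odot>\<^bsub>P\<^esub> (u \<otimes>\<^bsub>P\<^esub> v)"
proof
  fix k :: nat
  have "(u \<otimes>\<^bsub>P\<^esub> (c \<odot>\<^bsub>P\<^esub> v)) k =
      (\<Sum>(i, j)\<in>triangle k. \<Sum>l\<le>j. fps_nth c l \<odot> star (u i) (v (j - l)) (k - (i + j)))"
    using u v by (auto intro!: sum.cong
        simp: series_mult series_smult star_sum_right star_smult)
  also have "\<dots> = (\<Sum>((i, j), l)\<in>Sigma (triangle k) (\<lambda>(i, j). {..j}).
      fps_nth c l \<odot> star (u i) (v (j - l)) (k - (i + j)))"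
    by (simp add: sum.Sigma case_prod_unfold)
  also have "\<dots> = (\<Sum>(l, i, j)\<in>Sigma {..k} (\<lambda>l. triangle (k - l)).
      fps_nth c l \<odot> star (u i) (v j) (k - l - (i + j)))"
    by (rule sum.reindex_bij_witness[where
          i = "\<lambda>(l, i, j). ((i, j + l), l)" and j = "\<lambda>((i, j), l). (l, i, j - l)"])
      (auto simp: triangle_def algebra_simps)
  also have "\<dots> = (\<Sum>l\<le>k. \<Sum>(i, j)\<in>triangle (k - l).
      fps_nth c l \<odot> star (u i) (v j) (k - l - (i + j)))"
    by (simp add: sum.Sigma case_prod_unfold)
  also have "\<dots> = (c \<odot>\<^bsub>P\<^esub> (u \<otimes>\<^bsub>P\<^esub> v)) k"
    using u v by (simp add: series_smult series_mult_carrier series_mult smult_sum_right split_beta)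
  finally show "(u \<otimes>\<^bsub>P\<^esub> (c \<odot>\<^bsub>P\<^esub> v)) k = (c \<odot>\<^bsub>P\<^esub> (u \<otimes>\<^bsub>P\<^esub> v)) k" .
qed

lemma series_smult_one:
  assumes u: "\<And>k. u k \<in> carrier A"
  shows "1 \<odot>\<^bsub>P\<^esub> u = u"
proof
  fix k :: nat
  have "(1 \<odot>\<^bsub>P\<^esub> u) k = (\<Sum>i\<le>k. fps_nth 1 i \<odot> u (k - i))"
    using u by (rule series_smult)
  also have "\<dots> = (\<Sum>i\<in>{0}. fps_nth 1 i \<odot> u (k - i))"
    using u by (intro sum.mono_neutral_right) auto
  finally show "(1 \<odot>\<^bsub>P\<^esub> u) k = u k" using u by simp
qed

lemma series_module: "module (ring_of_type_algebra :: complex fps ring) P"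
proof (rule moduleI)
  show "cring (ring_of_type_algebra :: complex fps ring)"
    by (rule cring_from_type_algebra)
  show "(a \<otimes>\<^bsub>ring_of_type_algebra\<^esub> b) \<odot>\<^bsub>P\<^esub> x = a \<odot>\<^bsub>P\<^esub> (b \<odot>\<^bsub>P\<^esub> x)" if "x \<in> carrier P" for a b x
    using that by (simp add: ring_of_type_algebra_def series_carrier series_smult_smult)
qed (auto simp: series_abelian_group series_carrier series_add series_smult
      ring_of_type_algebra_def smult_add_left smult_add_right sum.distrib fun_eq_iff series_smult_one)

theorem formal_deformation: "formal_deformation A star"
proof -
  have "assoc_algebra ring_of_type_algebra P"
    by (auto simp: assoc_algebra_def series_module series_ring series_carrier
        series_smult_mult_left series_smult_mult_right)
  thus ?thesis
    using assoc_algebra star_bilinear star_0 by (auto simp: formal_deformation_def)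
qed

end

section \<open>Pairs of skew derivations\<close>

text \<open>The truncation is automatic: \<^term>\<open>qfact p i = 0\<close> in the truncated range, and \<open>1 / 0 = 0\<close>.\<close>

lemma qexp_nth: "fps_nth (qexp p) i = 1 / qfact p i"
proof (cases "\<exists>l\<ge>2. primitive_root_of_unity l p \<and> l \<le> i")
  case True
  then obtain l where l: "l \<ge> 2" "primitive_root_of_unity l p" "l \<le> i" by blast
  have pl: "p ^ l = 1" and p1: "p \<noteq> 1"
    using l(1,2) by (auto simp: primitive_root_of_unity_def dest: spec[of _ 1])
  have "qnum p l = 0"
    using sum_gp_strict[of p l] p1 pl by (simp add: qnum_def)
  hence "qfact p i = 0"
    using l by (auto simp: qfact_def intro!: bexI[of _ l])
  thus ?thesis using True by (simp add: qexp_def)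
qed (auto simp: qexp_def)

section \<open>q-numbers and q-factorials\<close>

lemma qnum_0 [simp]: "qnum p 0 = 0"
  by (simp add: qnum_def)

text \<open>This rule is behind both the q-Pascal recursion and the skew Leibniz rule for
  \<open>qdiff\<close>.\<close>

lemma qnum_add: "qnum p (m + n) = qnum p m + p ^ m * qnum p n"
  by (induction n) (simp_all add: qnum_def algebra_simps power_add)

lemma qfact_0 [simp]: "qfact p 0 = 1"
  by (simp add: qfact_def)

lemma qfact_Suc: "qfact p (Suc n) = qfact p n * qnum p (Suc n)"
  by (simp add: qfact_def)

lemma qfact_nonzero_mono: "qfact p n \<noteq> 0 \<Longrightarrow> k \<le> n \<Longrightarrow> qfact p k \<noteq> 0"
  by (auto simp: qfact_def)

section \<open>Linear operators and the q-binomial theorem\<close>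

context additive_algebra
begin

definition linear_operator :: "('a \<Rightarrow> 'a) \<Rightarrow> bool" where
  "linear_operator T \<longleftrightarrow> (\<forall>x\<in>carrier A. T x \<in> carrier A \<and> (\<forall>c. T (c \<odot> x) = c \<odot> T x) \<and>
     (\<forall>y\<in>carrier A. T (x + y) = T x + T y))"

lemma linear_operator_carrier: "linear_operator T \<Longrightarrow> x \<in> carrier A \<Longrightarrow> T x \<in> carrier A"
  by (simp add: linear_operator_def)

lemma linear_operator_smult: "linear_operator T \<Longrightarrow> x \<in> carrier A \<Longrightarrow> T (c \<odot> x) = c \<odot> T x"
  by (simp add: linear_operator_def)

lemma linear_operator_add:
  "linear_operator T \<Longrightarrow> x \<in> carrier A \<Longrightarrow> y \<in> carrier A \<Longrightarrow> T (x + y) = T x + T y"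
  by (simp add: linear_operator_def)

lemma linear_operator_zero: "linear_operator T \<Longrightarrow> T 0 = 0"
  using linear_operator_add[of T 0 0] by simp

lemma linear_operator_sum:
  "linear_operator T \<Longrightarrow> (\<And>i. i \<in> I \<Longrightarrow> f i \<in> carrier A) \<Longrightarrow> T (sum f I) = (\<Sum>i\<in>I. T (f i))"
  by (induction I rule: infinite_finite_induct)
    (auto simp: linear_operator_add linear_operator_zero)

lemma linear_operator_funpow: "linear_operator T \<Longrightarrow> linear_operator (T ^^ n)"
  by (induction n) (auto simp: linear_operator_def)

lemmas linear_operator_simps =
  linear_operator_carrier linear_operator_smult linear_operator_add linear_operator_zero

text \<open>
  Here \<open>T = X + Y\<close> with \<open>Y X = q X Y\<close>, and \<open>F k l\<close> is the value of \<open>X\<^sup>k Y\<^sup>l\<close> at a fixed element.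
\<close>

lemma q_binomial:
  assumes T: "linear_operator T" and F: "\<And>k l. F k l \<in> carrier A"
    and step: "\<And>k l. T (F k l) = F (Suc k) l + q ^ k \<odot> F k (Suc l)"
    and "qfact q n \<noteq> 0"
  shows "(1 / qfact q n) \<odot> (T ^^ n) (F 0 0) =
    (\<Sum>k\<le>n. (1 / (qfact q k * qfact q (n - k))) \<odot> F k (n - k))"
  using \<open>qfact q n \<noteq> 0\<close>
proof (induction n)
  case 0
  thus ?case using F by simp
next
  case (Suc n)
  define e where "e k l = 1 / (qfact q k * qfact q l)" for k l
  have nz: "qnum q (Suc n) \<noteq> 0" "qfact q n \<noteq> 0"
    using Suc.prems by (auto simp: qfact_Suc)
  \<comment> \<open>For \<open>k + l = n\<close>, both \<open>Suc k\<close> and \<open>Suc l\<close>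
    are at most \<open>Suc n\<close>, so their q-factorials are nonzero and the extra q-number
    cancels.\<close>
  have e1: "e k l = e (Suc k) l * qnum q (Suc k)" and e2: "e k l = e k (Suc l) * qnum q (Suc l)"
    if "k + l = n" for k l
    using qfact_nonzero_mono[OF Suc.prems, of "Suc k"] qfact_nonzero_mono[OF Suc.prems, of "Suc l"]
      that by (auto simp: e_def qfact_Suc)
  have "(1 / qfact q (Suc n)) \<odot> (T ^^ Suc n) (F 0 0) =
      (1 / qnum q (Suc n)) \<odot> T ((1 / qfact q n) \<odot> (T ^^ n) (F 0 0))"
    using T F linear_operator_funpow[OF T]
    by (simp add: linear_operator_simps smult_smult qfact_Suc mult.commute)
  also have "(1 / qfact q n) \<odot> (T ^^ n) (F 0 0) = (\<Sum>k\<le>n. e k (n - k) \<odot> F k (n - k))"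
    using Suc.IH nz by (simp add: e_def)
  also have "T \<dots> = (\<Sum>k\<le>n. e k (n - k) \<odot> F (Suc k) (n - k)) +
      (\<Sum>k\<le>n. (e k (n - k) * q ^ k) \<odot> F k (Suc (n - k)))"
    using T F by (simp add: linear_operator_sum linear_operator_simps step smult_add_right
        smult_smult sum.distrib)
  also have "(\<Sum>k\<le>n. e k (n - k) \<odot> F (Suc k) (n - k)) =
      (\<Sum>k\<le>n. (e (Suc k) (Suc n - Suc k) * qnum q (Suc k)) \<odot> F (Suc k) (Suc n - Suc k))"
    by (intro sum.cong refl) (simp add: e1)
  \<comment> \<open>After the shift, the added term at \<open>k = 0\<close> has the factor
    \<open>qnum q 0 = 0\<close>. The second sum is extended to \<open>k = Suc n\<close> below for
    the same reason.\<close>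
  also have "\<dots> = (\<Sum>k\<le>Suc n. (e k (Suc n - k) * qnum q k) \<odot> F k (Suc n - k))"
    using F by (subst sum.atMost_Suc_shift) simp
  also have "(\<Sum>k\<le>n. (e k (n - k) * q ^ k) \<odot> F k (Suc (n - k))) =
      (\<Sum>k\<le>n. (e k (Suc n - k) * (q ^ k * qnum q (Suc n - k))) \<odot> F k (Suc n - k))"
    by (intro sum.cong refl) (simp add: e2 Suc_diff_le mult_ac)
  also have "\<dots> = (\<Sum>k\<le>Suc n. (e k (Suc n - k) * (q ^ k * qnum q (Suc n - k))) \<odot> F k (Suc n - k))"
    using F by simp
  also have "(\<Sum>k\<le>Suc n. (e k (Suc n - k) * qnum q k) \<odot> F k (Suc n - k)) + \<dots> =
      (\<Sum>k\<le>Suc n. (e k (Suc n - k) * qnum q (Suc n)) \<odot> F k (Suc n - k))"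
    unfolding sum.distrib[symmetric]
  proof (intro sum.cong refl)
    fix k assume "k \<in> {..Suc n}"
    \<comment> \<open>The q-Pascal rule: the two coefficients add up to a multiple of
      \<open>qnum q (Suc n)\<close>, which the factor in front cancels.\<close>
    hence "qnum q (Suc n) = qnum q k + q ^ k * qnum q (Suc n - k)"
      using qnum_add[of q k "Suc n - k"] by simp
    thus "(e k (Suc n - k) * qnum q k) \<odot> F k (Suc n - k) +
        (e k (Suc n - k) * (q ^ k * qnum q (Suc n - k))) \<odot> F k (Suc n - k) =
        (e k (Suc n - k) * qnum q (Suc n)) \<odot> F k (Suc n - k)"
      using F by (simp add: smult_add_left[symmetric] distrib_left)
  qed
  also have "(1 / qnum q (Suc n)) \<odot> \<dots> = (\<Sum>k\<le>Suc n. e k (Suc n - k) \<odot> F k (Suc n - k))"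
    using F nz by (subst smult_sum_right) (auto simp: smult_smult)
  finally show ?case by (simp only: e_def)
qed

end

text \<open>\<open>qfact q n\<close> vanishes exactly when \<open>q\<close> is a root of unity of
  some order l with 2 \<le> l \<le> n. So the last two assumptions amount to nilpotency of order l,
  and are vacuous for all other \<open>q\<close>.\<close>

locale skew_derivation_pair = additive_algebra +
  fixes q :: complex and \<sigma> D1 D2 :: "'a \<Rightarrow> 'a"
  assumes linear_sigma: "linear_operator \<sigma>"
    and linear_D1: "linear_operator D1"
    and linear_D2: "linear_operator D2"
    and D1_mult: "a \<in> carrier A \<Longrightarrow> b \<in> carrier A \<Longrightarrow> D1 (a \<otimes> b) = D1 a \<otimes> \<sigma> b + a \<otimes> D1 b"
    and D2_mult: "a \<in> carrier A \<Longrightarrow> b \<in> carrier A \<Longrightarrow> D2 (a \<otimes> b) = D2 a \<otimes> b + \<sigma> a \<otimes> D2 b"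
    and D1_sigma: "a \<in> carrier A \<Longrightarrow> D1 (\<sigma> a) = q \<odot> \<sigma> (D1 a)"
    and D2_sigma: "a \<in> carrier A \<Longrightarrow> D2 (\<sigma> a) = q \<odot> \<sigma> (D2 a)"
    and D1_D2: "a \<in> carrier A \<Longrightarrow> D1 (D2 a) = D2 (D1 a)"
    and D1_one: "D1 \<one> = 0"
    and D2_one: "D2 \<one> = 0"
    and D1_nilpotent: "a \<in> carrier A \<Longrightarrow> qfact q n = 0 \<Longrightarrow> (D1 ^^ n) a = 0"
    and D2_nilpotent: "a \<in> carrier A \<Longrightarrow> qfact q n = 0 \<Longrightarrow> (D2 ^^ n) a = 0"
begin

section \<open>Powers of the skew derivations and associativity of the star product\<close>

lemmas operator_simps [simp] =
  linear_operator_carrier[OF linear_operator_funpow[OF linear_sigma]]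
  linear_operator_carrier[OF linear_operator_funpow[OF linear_D1]]
  linear_operator_carrier[OF linear_operator_funpow[OF linear_D2]]
  linear_operator_carrier[OF linear_sigma]
  linear_operator_carrier[OF linear_D1]
  linear_operator_carrier[OF linear_D2]
  linear_operator_smult[OF linear_sigma]
  linear_operator_smult[OF linear_operator_funpow[OF linear_D1]]
  linear_operator_smult[OF linear_operator_funpow[OF linear_D2]]

lemma D1_sigma_funpow: "a \<in> carrier A \<Longrightarrow> D1 ((\<sigma> ^^ k) a) = q ^ k \<odot> (\<sigma> ^^ k) (D1 a)"
  by (induction k) (auto simp: D1_sigma smult_smult)

lemma D2_sigma_funpow: "a \<in> carrier A \<Longrightarrow> D2 ((\<sigma> ^^ k) a) = q ^ k \<odot> (\<sigma> ^^ k) (D2 a)"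
  by (induction k) (auto simp: D2_sigma smult_smult)

lemma D1_D2_funpow:
  assumes "a \<in> carrier A"
  shows "(D1 ^^ m) ((D2 ^^ n) a) = (D2 ^^ n) ((D1 ^^ m) a)"
proof -
  have *: "D1 ((D2 ^^ n) a) = (D2 ^^ n) (D1 a)" if "a \<in> carrier A" for a
    using that by (induction n) (auto simp: D1_D2)
  show ?thesis using assms by (induction m) (auto simp: *)
qed

text \<open>On tensors \<open>D1\<close> acts as X + Y, where X applies \<open>D1\<close> to the
  left and \<open>\<sigma>\<close> to the right factor, and Y applies \<open>D1\<close> to the right
  factor. Moving \<open>D1\<close> past \<open>\<sigma>\<close> gives Y X = q X Y, so
  \<open>q_binomial\<close> applies.\<close>

lemma D1_funpow_mult:
  assumes "u \<in> carrier A" "v \<in> carrier A" "qfact q n \<noteq> 0"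
  shows "(1 / qfact q n) \<odot> (D1 ^^ n) (u \<otimes> v) =
    (\<Sum>k\<le>n. (1 / (qfact q k * qfact q (n - k))) \<odot> ((D1 ^^ k) u \<otimes> (\<sigma> ^^ k) ((D1 ^^ (n - k)) v)))"
  using q_binomial[of D1 "\<lambda>k l. (D1 ^^ k) u \<otimes> (\<sigma> ^^ k) ((D1 ^^ l) v)" q n] assms
  by (simp add: linear_D1 D1_mult D1_sigma_funpow mult_smult_right)

text \<open>Here X applies \<open>\<sigma>\<close> to the left and \<open>D2\<close> to the right
  factor, and Y applies \<open>D2\<close> to the left factor; again Y X = q X Y.\<close>

lemma D2_funpow_mult:
  assumes "u \<in> carrier A" "v \<in> carrier A" "qfact q n \<noteq> 0"
  shows "(1 / qfact q n) \<odot> (D2 ^^ n) (u \<otimes> v) =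
    (\<Sum>k\<le>n. (1 / (qfact q k * qfact q (n - k))) \<odot> ((\<sigma> ^^ k) ((D2 ^^ (n - k)) u) \<otimes> (D2 ^^ k) v))"
  using q_binomial[of D2 "\<lambda>k l. (\<sigma> ^^ k) ((D2 ^^ l) u) \<otimes> (D2 ^^ k) v" q n] assms
  by (simp add: linear_D2 D2_mult D2_sigma_funpow mult_smult_left add.commute)

abbreviation "star \<equiv> qexp_star A q D1 D2"

lemma star_eq: "star a b i = (1 / qfact q i) \<odot> ((D1 ^^ i) a \<otimes> (D2 ^^ i) b)"
  by (simp add: qexp_star_def qexp_nth)

text \<open>
  If \<open>qfact q n = 0\<close>, then \<open>1 / qfact q n = 0\<close> on the left, while on the right the terms with
  \<open>k < n\<close> survive unless \<open>(D2 ^^ n) c = 0\<close>; so here the nilpotency of \<open>D2\<close> is essential.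
\<close>

lemma star_mult_left:
  assumes "u \<in> carrier A" "v \<in> carrier A" "c \<in> carrier A"
  shows "star (u \<otimes> v) c n = (\<Sum>k\<le>n. (1 / (qfact q k * qfact q (n - k))) \<odot>
    ((D1 ^^ k) u \<otimes> (\<sigma> ^^ k) ((D1 ^^ (n - k)) v) \<otimes> (D2 ^^ n) c))"
proof (cases "qfact q n = 0")
  case True
  thus ?thesis using assms by (simp add: star_eq D2_nilpotent)
next
  case False
  have "star (u \<otimes> v) c n = ((1 / qfact q n) \<odot> (D1 ^^ n) (u \<otimes> v)) \<otimes> (D2 ^^ n) c"
    using assms by (simp add: star_eq mult_smult_left)
  thus ?thesis
    using assms False by (simp add: D1_funpow_mult mult_sum_left mult_smult_left)
qed

lemma star_mult_right:
  assumes "u \<in> carrier A" "v \<in> carrier A" "c \<in> carrier A"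
  shows "star c (u \<otimes> v) n = (\<Sum>k\<le>n. (1 / (qfact q k * qfact q (n - k))) \<odot>
    ((D1 ^^ n) c \<otimes> ((\<sigma> ^^ k) ((D2 ^^ (n - k)) u) \<otimes> (D2 ^^ k) v)))"
proof (cases "qfact q n = 0")
  case True
  thus ?thesis using assms by (simp add: star_eq D1_nilpotent)
next
  case False
  have "star c (u \<otimes> v) n = (D1 ^^ n) c \<otimes> ((1 / qfact q n) \<odot> (D2 ^^ n) (u \<otimes> v))"
    using assms by (simp add: star_eq mult_smult_right)
  thus ?thesis
    using assms False by (simp add: D2_funpow_mult mult_sum_right mult_smult_right)
qed

lemma bilinear_star: "bilinear_on A (\<lambda>a b. star a b i)"
  unfolding bilinear_on_def
  by (auto simp: star_eq add_eq mult_add_left mult_add_right smult_add_right mult_smult_left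
      mult_smult_right smult_smult mult.commute
      linear_operator_add[OF linear_operator_funpow[OF linear_D1]]
      linear_operator_add[OF linear_operator_funpow[OF linear_D2]])

lemma star_smult:
  assumes "a \<in> carrier A" "b \<in> carrier A"
  shows "star (z \<odot> a) b i = z \<odot> star a b i" "star a (z \<odot> b) i = z \<odot> star a b i"
  using bilinear_star[of i] assms by (auto simp: bilinear_on_def)

lemma star_associative:
  assumes "a \<in> carrier A" "b \<in> carrier A" "c \<in> carrier A"
  shows "(\<Sum>i\<le>n. star (star a b i) c (n - i)) = (\<Sum>i\<le>n. star a (star b c i) (n - i))"
proof -
  define e where "e i j k = 1 / (qfact q i * qfact q j * qfact q k)" for i j k
  have "(\<Sum>i\<le>n. star (star a b i) c (n - i)) =
      (\<Sum>i\<le>n. (1 / qfact q i) \<odot> star ((D1 ^^ i) a \<otimes> (D2 ^^ i) b) c (n - i))"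
    using assms by (intro sum.cong refl) (subst star_eq[of a], simp add: star_smult)
  also have "\<dots> = (\<Sum>i\<le>n. \<Sum>k\<le>n - i. e i k (n - i - k) \<odot>
      ((D1 ^^ (k + i)) a \<otimes> (\<sigma> ^^ k) ((D1 ^^ (n - i - k)) ((D2 ^^ i) b)) \<otimes> (D2 ^^ (n - i)) c))"
    using assms by (simp add: star_mult_left smult_sum_right smult_smult e_def funpow_add mult_ac
        del: diff_diff_left)
  also have "\<dots> = (\<Sum>(i, k)\<in>Sigma {..n} (\<lambda>i. {..n - i}). e i k (n - i - k) \<odot>
      ((D1 ^^ (k + i)) a \<otimes> (\<sigma> ^^ k) ((D1 ^^ (n - i - k)) ((D2 ^^ i) b)) \<otimes> (D2 ^^ (n - i)) c))"
    by (simp add: sum.Sigma)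
  also have "\<dots> = (\<Sum>(i, k)\<in>Sigma {..n} (\<lambda>i. {..n - i}). e i k (n - i - k) \<odot>
      ((D1 ^^ (n - i)) a \<otimes> ((\<sigma> ^^ k) ((D2 ^^ (n - i - k)) ((D1 ^^ i) b)) \<otimes> (D2 ^^ (k + i)) c)))"
  \<comment> \<open>With \<open>l = n - i - k\<close>, the two sums differ by exchanging
    \<open>i\<close> and \<open>l\<close>, an involution for fixed \<open>k\<close>. The weight
    \<open>e\<close> is symmetric, and the powers of \<open>D1\<close> and \<open>D2\<close> on
    \<open>b\<close> commute.\<close>
  proof (rule sum.reindex_bij_witness[where
        i = "\<lambda>(i, k). (n - i - k, k)" and j = "\<lambda>(i, k). (n - i - k, k)"])
    fix x assume "x \<in> Sigma {..n} (\<lambda>i. {..n - i})"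
    then obtain i k where x: "x = (i, k)" "i + k \<le> n" by auto
    define l where "l = n - i - k"
    have n: "n = i + k + l" using x by (simp add: l_def)
    show "(case case x of (i, k) \<Rightarrow> (n - i - k, k) of (i, k) \<Rightarrow> e i k (n - i - k) \<odot>
          ((D1 ^^ (n - i)) a \<otimes> ((\<sigma> ^^ k) ((D2 ^^ (n - i - k)) ((D1 ^^ i) b)) \<otimes> (D2 ^^ (k + i)) c))) =
        (case x of (i, k) \<Rightarrow> e i k (n - i - k) \<odot>
          ((D1 ^^ (k + i)) a \<otimes> (\<sigma> ^^ k) ((D1 ^^ (n - i - k)) ((D2 ^^ i) b)) \<otimes> (D2 ^^ (n - i)) c))"
      using assms by (simp add: x n m_assoc D1_D2_funpow e_def mult_ac add_ac)
  qed auto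
  also have "\<dots> = (\<Sum>i\<le>n. \<Sum>k\<le>n - i. e i k (n - i - k) \<odot>
      ((D1 ^^ (n - i)) a \<otimes> ((\<sigma> ^^ k) ((D2 ^^ (n - i - k)) ((D1 ^^ i) b)) \<otimes> (D2 ^^ (k + i)) c)))"
    by (simp add: sum.Sigma)
  also have "\<dots> = (\<Sum>i\<le>n. (1 / qfact q i) \<odot> star a ((D1 ^^ i) b \<otimes> (D2 ^^ i) c) (n - i))"
    using assms by (simp add: star_mult_right smult_sum_right smult_smult e_def funpow_add mult_ac
        del: diff_diff_left)
  also have "\<dots> = (\<Sum>i\<le>n. star a (star b c i) (n - i))"
    using assms by (intro sum.cong refl) (subst star_eq[of b], simp add: star_smult)
  finally show ?thesis .
qed

theorem formal_deformation_qexp_star: "formal_deformation A star"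
proof -
  \<comment> \<open>The innermost application already kills the unit, so every term of positive
    order in a product with the unit vanishes.\<close>
  have one: "(D1 ^^ n) \<one> = 0" "(D2 ^^ n) \<one> = 0" if "n > 0" for n
    using that by (cases n; simp add: funpow_swap1 D1_one D2_one
        linear_operator_zero[OF linear_operator_funpow[OF linear_D1]]
        linear_operator_zero[OF linear_operator_funpow[OF linear_D2]])+
  interpret associative_star A star
    by unfold_locales
      (auto simp: bilinear_star star_associative, auto simp: star_eq one)
  show ?thesis by (rule formal_deformation)
qed

end

section \<open>Polynomials\<close>

no_notation fps_nth (infixl \<open>$\<close> 75)

section \<open>Induction and summation for finitely supported functions\<close>

lemma poly_mapping_eq_sum_single:
  fixes p :: "'a \<Rightarrow>\<^sub>0 'b::comm_monoid_add"
  shows "p = (\<Sum>k\<in>Poly_Mapping.keys p. Poly_Mapping.single k (Poly_Mapping.lookup p k))"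
  by (rule poly_mapping_eqI) (auto simp: lookup_sum lookup_single when_def in_keys_iff)

text \<open>The support condition serves two purposes: membership in the carrier of the crossed
  product (keys in G), and polynomials free of a variable (exponent 0 in every key).\<close>

lemma poly_mapping_induct_on [consumes 1, case_names zero single add]:
  fixes p :: "'a \<Rightarrow>\<^sub>0 'b::comm_monoid_add"
  assumes "Poly_Mapping.keys p \<subseteq> S"
    and "P 0" "\<And>k c. k \<in> S \<Longrightarrow> P (Poly_Mapping.single k c)" "\<And>a b. P a \<Longrightarrow> P b \<Longrightarrow> P (a + b)"
  shows "P p"
proof -
  have "P (\<Sum>k\<in>I. Poly_Mapping.single k (Poly_Mapping.lookup p k))"
    if "I \<subseteq> Poly_Mapping.keys p" for I
    using finite_subset[OF that finite_keys] that assms(1)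
    by (induction I rule: finite_induct) (auto intro!: assms(2-4))
  from this[OF order_refl] show ?thesis
    by (simp add: poly_mapping_eq_sum_single[symmetric])
qed

lemma poly_mapping_induct [case_names single add]:
  fixes p :: "'a \<Rightarrow>\<^sub>0 'b::comm_monoid_add"
  assumes "\<And>k c. P (Poly_Mapping.single k c)" "\<And>a b. P a \<Longrightarrow> P b \<Longrightarrow> P (a + b)"
  shows "P p"
  using assms(1)[of _ 0] by (intro poly_mapping_induct_on[of p UNIV P] assms) auto

text \<open>The operations of the development sum over \<open>keys\<close>, and the support can
  shrink under addition. Isolating this pattern reduces additivity to a condition on the summands,
  see \<open>pm_sum_add\<close>.\<close>

definition pm_sum :: "('a \<Rightarrow> 'b::comm_monoid_add \<Rightarrow> 'c::comm_monoid_add) \<Rightarrow> ('a \<Rightarrow>\<^sub>0 'b) \<Rightarrow> 'c" where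
  "pm_sum f p = (\<Sum>k\<in>Poly_Mapping.keys p. f k (Poly_Mapping.lookup p k))"

lemma pm_sum_zero [simp]: "pm_sum f 0 = 0"
  by (simp add: pm_sum_def)

lemma pm_sum_zero_fun [simp]: "pm_sum (\<lambda>k c. 0) p = 0"
  by (simp add: pm_sum_def)

lemma pm_sum_single: "f k 0 = 0 \<Longrightarrow> pm_sum f (Poly_Mapping.single k c) = f k c"
  by (cases "c = 0") (auto simp: pm_sum_def)

lemma pm_sum_add:
  assumes "\<And>k. f k 0 = 0" "\<And>k a b. f k (a + b) = f k a + f k b"
  shows "pm_sum f (p + p') = pm_sum f p + pm_sum f p'"
  unfolding pm_sum_def using assms by (intro setsum_keys_plus_distrib)

lemma pm_sum_add_fun: "pm_sum (\<lambda>k c. f k c + f' k c) p = pm_sum f p + pm_sum f' p"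
  by (simp add: pm_sum_def sum.distrib)

section \<open>Constants, variables and monomials of S(V)\<close>

lemma pconst_0 [simp]: "pconst 0 = 0"
  and pconst_1 [simp]: "pconst 1 = 1"
  and pconst_add: "pconst (a + b) = pconst a + pconst b"
  and pconst_mult: "pconst (a * b) = pconst a * pconst b"
  by (simp_all add: pconst_def single_add mult_single)

lemma pconst_power: "pconst (a ^ n) = pconst a ^ n"
  by (induction n) (simp_all add: pconst_mult)

lemma pconst_sum: "pconst (sum f I) = (\<Sum>i\<in>I. pconst (f i))"
  by (induction I rule: infinite_finite_induct) (simp_all add: pconst_add)

lemma pconst_prod: "pconst (prod f I) = (\<Prod>i\<in>I. pconst (f i))"
  by (induction I rule: infinite_finite_induct) (simp_all add: pconst_mult)

lemma pconst_mult_single: "pconst c * Poly_Mapping.single m d = Poly_Mapping.single m (c * d)"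
  by (simp add: pconst_def mult_single)

definition pvar :: "'n \<Rightarrow> 'n mpoly" where
  "pvar i = Poly_Mapping.single (Poly_Mapping.single i 1) 1"

lemma pvar_power: "pvar i ^ k = Poly_Mapping.single (Poly_Mapping.single i k) 1"
  by (induction k) (simp_all add: pvar_def mult_single single_add[symmetric])

lemma prod_single_one:
  "(\<Prod>j\<in>I. Poly_Mapping.single (f j) (1::complex)) = Poly_Mapping.single (\<Sum>j\<in>I. f j) 1"
  by (induction I rule: infinite_finite_induct) (simp_all add: mult_single)

lemma monomial_eq_prod:
  fixes m :: "'n::finite \<Rightarrow>\<^sub>0 nat"
  shows "Poly_Mapping.single m c = pconst c * (\<Prod>j\<in>UNIV. pvar j ^ Poly_Mapping.lookup m j)"
proof -
  have "(\<Sum>j\<in>UNIV. Poly_Mapping.single j (Poly_Mapping.lookup m j)) = m"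
    by (rule poly_mapping_eqI) (simp add: lookup_sum lookup_single when_def)
  thus ?thesis by (simp add: pvar_power prod_single_one pconst_mult_single)
qed

text \<open>Constants and variables generate S(V) as a ring, so statements about homomorphisms and
  skew derivations are checked on them.\<close>

lemma mpoly_induct [case_names const var add mult]:
  fixes p :: "'n::finite mpoly"
  assumes const: "\<And>c. P (pconst c)" and var: "\<And>i. P (pvar i)"
    and add: "\<And>x y. P x \<Longrightarrow> P y \<Longrightarrow> P (x + y)" and mult: "\<And>x y. P x \<Longrightarrow> P y \<Longrightarrow> P (x * y)"
  shows "P p"
proof (induction p rule: poly_mapping_induct)
  case (single m c)
  have one: "P 1" using const[of 1] by simp
  have pow: "P (pvar j ^ k)" for j k
    by (induction k) (auto simp: one var mult)
  have "P (\<Prod>j\<in>I. pvar j ^ Poly_Mapping.lookup m j)" for I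
    by (induction I rule: infinite_finite_induct) (auto simp: one pow mult)
  thus ?case by (simp add: monomial_eq_prod mult const)
qed (rule add)

section \<open>Matrices acting on S(V)\<close>

lemma linear_form_eq: "linear_form v = (\<Sum>i\<in>UNIV. pconst (v $ i) * pvar i)"
  by (simp add: linear_form_def pvar_def pconst_mult_single)

lemma linear_form_scale_axis: "linear_form (c *s axis j 1) = pconst c * pvar j"
proof -
  have "linear_form (c *s axis j 1) = (\<Sum>i\<in>UNIV. if i = j then pconst c * pvar i else 0)"
    unfolding linear_form_eq by (intro sum.cong) (auto simp: axis_def)
  thus ?thesis by simp
qed

lemma matrix_vector_axis: "(M *v axis j 1) $ i = M $ i $ j" for M :: "complex ^ 'n ^ 'm"
  by (simp add: matrix_vector_mult_def axis_def if_distrib cong: if_cong)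

lemma sym_act_single:
  "sym_act M (Poly_Mapping.single m c) =
    pconst c * (\<Prod>j\<in>UNIV. linear_form (M *v axis j 1) ^ Poly_Mapping.lookup m j)"
  by (cases "c = 0") (simp_all add: sym_act_def)

lemma sym_act_add: "sym_act M (x + y) = sym_act M x + sym_act M y"
  unfolding sym_act_def
  by (rule setsum_keys_plus_distrib) (simp_all add: pconst_add algebra_simps)

lemma sym_act_0 [simp]: "sym_act M 0 = 0"
  by (simp add: sym_act_def)

lemma sym_act_pconst [simp]: "sym_act M (pconst c) = pconst c"
  by (simp only: pconst_def[of c] sym_act_single) (simp add: pconst_def)

lemma sym_act_1 [simp]: "sym_act M 1 = 1"
  using sym_act_pconst[of M 1] by simp

lemma sym_act_sum: "sym_act M (sum f I) = (\<Sum>i\<in>I. sym_act M (f i))"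
  by (induction I rule: infinite_finite_induct) (simp_all add: sym_act_add)

lemma sym_act_mult: "sym_act M (x * y) = sym_act M x * sym_act M y"
proof (induction x rule: poly_mapping_induct)
  case (single m c)
  show ?case
  proof (induction y rule: poly_mapping_induct)
    case (single m' c')
    show ?case
      by (simp add: mult_single sym_act_single lookup_add power_add prod.distrib pconst_mult mult_ac)
  qed (simp add: distrib_left sym_act_add)
qed (simp add: distrib_right sym_act_add)

lemma sym_act_pvar [simp]: "sym_act M (pvar i) = linear_form (M *v axis i 1)"
proof -
  have "(\<Prod>j\<in>UNIV. linear_form (M *v axis j 1) ^ Poly_Mapping.lookup (Poly_Mapping.single i 1) j) =
      (\<Prod>j\<in>UNIV. if i = j then linear_form (M *v axis j 1) else 1)"
    by (intro prod.cong) (auto simp: lookup_single when_def)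
  thus ?thesis by (simp add: pvar_def sym_act_single)
qed

lemma sym_act_linear_form: "sym_act M (linear_form v) = linear_form (M *v v)"
proof -
  have "sym_act M (linear_form v) = (\<Sum>j\<in>UNIV. \<Sum>i\<in>UNIV. pconst (M $ i $ j * v $ j) * pvar i)"
    by (simp add: linear_form_eq[of v] sym_act_sum sym_act_mult linear_form_eq[of "M *v _"]
        matrix_vector_axis sum_distrib_left pconst_mult mult_ac)
  also have "\<dots> = (\<Sum>i\<in>UNIV. pconst (\<Sum>j\<in>UNIV. M $ i $ j * v $ j) * pvar i)"
    by (subst sum.swap) (simp add: pconst_sum sum_distrib_right)
  finally show ?thesis by (simp add: linear_form_eq matrix_vector_mult_def)
qed

text \<open>Both sides are algebra endomorphisms of S(V), so they are compared on the variables,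
  where the matrix product acts by composition.\<close>

lemma sym_act_compose: "sym_act (M ** N) p = sym_act M (sym_act N p)"
  by (induction p rule: mpoly_induct)
    (simp_all add: sym_act_linear_form matrix_vector_mul_assoc sym_act_add sym_act_mult)

lemma sym_act_mat_1 [simp]:
  fixes p :: "'n::finite mpoly"
  shows "sym_act (mat 1) p = p"
proof -
  have "linear_form (axis j 1) = pvar j" for j :: 'n
    using linear_form_scale_axis[of 1 j] by simp
  thus ?thesis
    by (induction p rule: mpoly_induct) (simp_all add: sym_act_add sym_act_mult)
qed

text \<open>The twist of a q-derivation is encoded as the action of a diagonal matrix. It thus lives
  on the same footing as the group action, and commutation of the two becomes a matrix
  identity.\<close>

definition scale_axis :: "'n \<Rightarrow> complex \<Rightarrow> complex ^ 'n ^ 'n::finite" where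
  "scale_axis i c = (\<chi> a b. if a = b then if a = i then c else 1 else 0)"

lemma scale_axis_axis: "scale_axis i c *v axis j 1 = (if j = i then c else 1) *s axis j 1"
  unfolding vec_eq_iff matrix_vector_axis
  by (auto simp: scale_axis_def axis_def)

lemma scale_axis_mult_nth: "(scale_axis i c ** M) $ a $ b = (if a = i then c else 1) * M $ a $ b"
proof -
  have "(scale_axis i c ** M) $ a $ b =
      (\<Sum>k\<in>UNIV. if a = k then (if a = i then c else 1) * M $ k $ b else 0)"
    by (simp only: matrix_matrix_mult_def scale_axis_def vec_lambda_beta, intro sum.cong refl) auto
  thus ?thesis by simp
qed

lemma mult_scale_axis_nth: "(M ** scale_axis i c) $ a $ b = M $ a $ b * (if b = i then c else 1)"
proof -
  have "(M ** scale_axis i c) $ a $ b =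
      (\<Sum>k\<in>UNIV. if b = k then M $ a $ k * (if b = i then c else 1) else 0)"
    by (simp only: matrix_matrix_mult_def scale_axis_def vec_lambda_beta, intro sum.cong refl) auto
  thus ?thesis by simp
qed

lemma sym_act_scale_axis:
  "sym_act (scale_axis i c) (Poly_Mapping.single m a) =
    Poly_Mapping.single m (a * c ^ Poly_Mapping.lookup m i)"
proof -
  have "(\<Prod>j\<in>UNIV. linear_form (scale_axis i c *v axis j 1) ^ Poly_Mapping.lookup m j) =
      (\<Prod>j\<in>UNIV. pconst (if j = i then c ^ Poly_Mapping.lookup m i else 1)) *
      (\<Prod>j\<in>UNIV. pvar j ^ Poly_Mapping.lookup m j)"
    unfolding prod.distrib[symmetric] scale_axis_axis linear_form_scale_axis power_mult_distrib
      pconst_power[symmetric] by (intro prod.cong) auto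
  thus ?thesis
    by (simp add: sym_act_single monomial_eq_prod[of m "a * _"] pconst_prod[symmetric] pconst_mult
        mult_ac)
qed

section \<open>q-differentiation as a skew derivation\<close>

lemma qdiff_single:
  "qdiff i p (Poly_Mapping.single m c) =
    Poly_Mapping.single (m - Poly_Mapping.single i 1) (qnum p (Poly_Mapping.lookup m i) * c)"
  by (cases "c = 0") (simp_all add: qdiff_def)

lemma qdiff_add: "qdiff i p (x + y) = qdiff i p x + qdiff i p y"
  unfolding qdiff_def
  by (rule setsum_keys_plus_distrib) (simp_all add: single_add[symmetric] algebra_simps)

lemma qdiff_0 [simp]: "qdiff i p 0 = 0"
  by (simp add: qdiff_def)

lemma qdiff_sum: "qdiff i p (sum f I) = (\<Sum>j\<in>I. qdiff i p (f j))"
  by (induction I rule: infinite_finite_induct) (simp_all add: qdiff_add)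

lemma qdiff_pconst [simp]: "qdiff i p (pconst c) = 0"
  by (simp add: pconst_def qdiff_single)

lemma qdiff_pvar: "qdiff i p (pvar j) = (if i = j then 1 else 0)"
proof (cases "i = j")
  case True
  thus ?thesis by (simp add: pvar_def qdiff_single qnum_def)
next
  case False
  hence "Poly_Mapping.lookup (Poly_Mapping.single j (1::nat)) i = 0"
    by (simp add: lookup_single_not_eq)
  thus ?thesis using False by (simp add: pvar_def qdiff_single)
qed

text \<open>On monomials this is \<open>qnum_add\<close> for the exponents of the variable with
  index \<open>i\<close>.\<close>

lemma qdiff_mult:
  "qdiff i p (x * y) = qdiff i p x * sym_act (scale_axis i p) y + x * qdiff i p y"
proof (induction x rule: poly_mapping_induct)
  case (single m c)
  show ?case
  proof (induction y rule: poly_mapping_induct)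
    case (single m' c')
    let ?e = "Poly_Mapping.single i (1::nat)"
    let ?k = "Poly_Mapping.lookup m i" and ?k' = "Poly_Mapping.lookup m' i"
    \<comment> \<open>The truncated subtraction can be moved onto one summand only if that exponent
      is positive; if it is 0, the coefficient contains \<open>qnum p 0 = 0\<close>. The next fact
      treats the other summand.\<close>
    have 1: "Poly_Mapping.single (m + m' - ?e) (qnum p ?k * a) =
        Poly_Mapping.single (m - ?e + m') (qnum p ?k * a)" for a
    proof (cases "?k = 0")
      case False
      hence "m + m' - ?e = m - ?e + m'"
        by (intro poly_mapping_eqI) (auto simp: lookup_add lookup_minus lookup_single when_def)
      thus ?thesis by simp
    qed simp
    have 2: "Poly_Mapping.single (m + m' - ?e) (qnum p ?k' * a) =
        Poly_Mapping.single (m + (m' - ?e)) (qnum p ?k' * a)" for a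
    proof (cases "?k' = 0")
      case False
      hence "m + m' - ?e = m + (m' - ?e)"
        by (intro poly_mapping_eqI) (auto simp: lookup_add lookup_minus lookup_single when_def)
      thus ?thesis by simp
    qed simp
    have "qdiff i p (Poly_Mapping.single m c * Poly_Mapping.single m' c') =
        Poly_Mapping.single (m + m' - ?e) (qnum p ?k * (p ^ ?k' * c * c')) +
        Poly_Mapping.single (m + m' - ?e) (qnum p ?k' * (c * c'))"
      using qnum_add[of p ?k' ?k]
      by (simp add: mult_single qdiff_single lookup_add single_add[symmetric] algebra_simps)
    thus ?case
      unfolding 1 2 by (simp add: mult_single qdiff_single sym_act_scale_axis mult_ac add_ac)
  qed (simp add: distrib_left qdiff_add sym_act_add add_ac)
qed (simp add: distrib_right qdiff_add add_ac)

lemma qdiff_pconst_mult: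
  fixes x :: "'n::finite mpoly"
  shows "qdiff i p (pconst c * x) = pconst c * qdiff i p x"
  by (simp add: qdiff_mult)

text \<open>Differentiation lowers the exponent by one, so scaling first produces one more factor
  \<open>c\<close>; for exponent 0 both sides vanish.\<close>

lemma qdiff_scale_axis_same:
  "qdiff i p (sym_act (scale_axis i c) x) = pconst c * sym_act (scale_axis i c) (qdiff i p x)"
proof (induction x rule: poly_mapping_induct)
  case (single m a)
  show ?case
    by (cases "Poly_Mapping.lookup m i")
      (simp_all add: sym_act_scale_axis qdiff_single pconst_mult_single lookup_minus mult_ac)
qed (simp add: sym_act_add qdiff_add distrib_left)

lemma qdiff_scale_axis_other:
  "i \<noteq> j \<Longrightarrow> qdiff i p (sym_act (scale_axis j c) x) = sym_act (scale_axis j c) (qdiff i p x)"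
  by (induction x rule: poly_mapping_induct)
    (simp_all add: sym_act_scale_axis qdiff_single lookup_minus lookup_single_not_eq
      sym_act_add qdiff_add mult_ac)

lemma qdiff_commute:
  assumes "i \<noteq> j"
  shows "qdiff i p (qdiff j p' x) = qdiff j p' (qdiff i p x)"
proof (induction x rule: poly_mapping_induct)
  case (single m c)
  have "m - Poly_Mapping.single j 1 - Poly_Mapping.single i 1 =
      m - Poly_Mapping.single i 1 - Poly_Mapping.single j 1"
    by (rule poly_mapping_eqI) (simp add: lookup_minus)
  thus ?case
    using assms by (simp add: qdiff_single lookup_minus lookup_single_not_eq mult_ac)
qed (simp add: qdiff_add)

text \<open>If \<open>n\<close> exceeds the exponent, the product contains
  \<open>qnum p 0 = 0\<close>, so the truncated subtractions are harmless.\<close>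

lemma qdiff_funpow_single:
  "(qdiff i p ^^ n) (Poly_Mapping.single m c) = Poly_Mapping.single (m - Poly_Mapping.single i n)
    ((\<Prod>j<n. qnum p (Poly_Mapping.lookup m i - j)) * c)"
proof (induction n)
  case (Suc n)
  have "m - Poly_Mapping.single i n - Poly_Mapping.single i 1 = m - Poly_Mapping.single i (Suc n)"
    by (rule poly_mapping_eqI) (auto simp: lookup_minus lookup_single when_def)
  thus ?case using Suc by (simp add: qdiff_single lookup_minus mult_ac)
qed simp

lemma qdiff_funpow_add: "(qdiff i p ^^ n) (x + y) = (qdiff i p ^^ n) x + (qdiff i p ^^ n) y"
  by (induction n) (simp_all add: qdiff_add)

lemma qnum_mult_eq_0: "qnum p l = 0 \<Longrightarrow> qnum p (l * k) = 0"
  by (induction k) (simp_all add: qnum_add)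

lemma qdiff_nilpotent:
  assumes "qfact p n = 0"
  shows "(qdiff i p ^^ n) x = 0"
proof (induction x rule: poly_mapping_induct)
  case (single m c)
  obtain l where l: "1 \<le> l" "l \<le> n" "qnum p l = 0"
    using assms by (auto simp: qfact_def)
  define k where "k = Poly_Mapping.lookup m i"
  \<comment> \<open>Lowering the exponent \<open>k\<close> step by step reaches a multiple of
    \<open>l\<close> after \<open>k mod l < n\<close> steps. The q-number vanishes there because it
    vanishes at \<open>l\<close>.\<close>
  have "qnum p (k - k mod l) = 0"
    using qnum_mult_eq_0[OF l(3), of "k div l"] by (simp add: minus_mod_eq_mult_div)
  moreover have "k mod l < n" using l by (meson mod_less_divisor less_le_trans zero_less_one)
  ultimately have "(\<Prod>j<n. qnum p (k - j)) = 0" by auto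
  thus ?case by (simp only: qdiff_funpow_single k_def mult_zero_left single_zero)
qed (simp add: qdiff_funpow_add)

text \<open>By \<open>comm\<close>, both sides obey the same skew Leibniz rule along
  \<open>sym_act M\<close>, so the variables decide. There \<open>row\<close> says that no image of
  another variable involves the one with index \<open>i\<close>.\<close>

lemma qdiff_sym_act:
  fixes M :: "complex ^ 'n ^ 'n::finite"
  assumes row: "\<And>j. j \<noteq> i \<Longrightarrow> M $ i $ j = 0"
    and comm: "scale_axis i p ** M = M ** scale_axis i p"
  shows "qdiff i p (sym_act M x) = pconst (M $ i $ i) * sym_act M (qdiff i p x)"
proof (induction x rule: mpoly_induct)
  case (var j)
  have "qdiff i p (linear_form (M *v axis j 1)) = (\<Sum>k\<in>UNIV. if i = k then pconst (M $ k $ j) else 0)"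
    unfolding linear_form_eq qdiff_sum qdiff_pconst_mult qdiff_pvar matrix_vector_axis
    by (intro sum.cong) auto
  thus ?case using row[of j] by (auto simp: qdiff_pvar)
next
  case (mult x y)
  thus ?case
    by (simp add: sym_act_mult qdiff_mult sym_act_add sym_act_compose[symmetric] comm algebra_simps)
qed (simp_all add: sym_act_add qdiff_add distrib_left)

lemma qdiff_free_of:
  assumes "\<forall>m\<in>Poly_Mapping.keys s. Poly_Mapping.lookup m i = 0"
  shows "qdiff i p s = 0"
proof -
  have "Poly_Mapping.keys s \<subseteq> {m. Poly_Mapping.lookup m i = 0}" using assms by auto
  thus ?thesis by (induction s rule: poly_mapping_induct_on) (auto simp: qdiff_single qdiff_add)
qed

lemma sym_act_scale_axis_free_of:
  assumes "\<forall>m\<in>Poly_Mapping.keys s. Poly_Mapping.lookup m i = 0"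
  shows "sym_act (scale_axis i c) s = s"
proof -
  have "Poly_Mapping.keys s \<subseteq> {m. Poly_Mapping.lookup m i = 0}" using assms by auto
  thus ?thesis
    by (induction s rule: poly_mapping_induct_on) (auto simp: sym_act_scale_axis sym_act_add)
qed

section \<open>The crossed product\<close>

lemma lookup_cp_scale [simp]: "Poly_Mapping.lookup (cp_scale c a) h = pconst c * Poly_Mapping.lookup a h"
  by (simp add: cp_scale_def map.rep_eq when_def)

lemma cp_scale_single [simp]:
  "cp_scale c (Poly_Mapping.single h r) = Poly_Mapping.single h (pconst c * r)"
  by (simp add: cp_scale_def)

lemma cp_scale_add_right: "cp_scale c (a + b) = cp_scale c a + cp_scale c b"
  by (rule poly_mapping_eqI) (simp add: lookup_add distrib_left)

lemma cp_scale_add_left: "cp_scale (c + d) a = cp_scale c a + cp_scale d a"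
  by (rule poly_mapping_eqI) (simp add: lookup_add pconst_add distrib_right)

lemma cp_scale_cp_scale: "cp_scale c (cp_scale d a) = cp_scale (c * d) a"
  by (rule poly_mapping_eqI) (simp add: pconst_mult mult.assoc)

lemma cp_scale_1 [simp]: "cp_scale 1 a = a"
  by (rule poly_mapping_eqI) simp

lemma cp_scale_zero [simp]: "cp_scale 0 a = 0"
  by (rule poly_mapping_eqI) simp

lemma cp_scale_zero_right [simp]: "cp_scale c 0 = 0"
  by (rule poly_mapping_eqI) simp

lemma keys_cp_scale: "Poly_Mapping.keys (cp_scale c a) \<subseteq> Poly_Mapping.keys a"
  by (auto simp: in_keys_iff)

lemma cp_extend_eq: "cp_extend f a = pm_sum (\<lambda>h. pm_sum (\<lambda>m c. cp_scale c (f m h))) a"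
  by (simp add: cp_extend_def pm_sum_def)

lemma cp_extend_add: "cp_extend f (a + b) = cp_extend f a + cp_extend f b"
  unfolding cp_extend_eq by (intro pm_sum_add) (simp_all add: cp_scale_add_left pm_sum_add)

text \<open>Turns a description on basis elements into a closed formula \<open>F\<close> in the
  coefficient polynomial; additivity of \<open>F\<close> does the rest.\<close>

lemma cp_extend_single:
  assumes "\<And>m c. cp_scale c (f m h) = F (Poly_Mapping.single m c)" "\<And>x y. F (x + y) = F x + F y"
  shows "cp_extend f (Poly_Mapping.single h r) = F r"
proof -
  have "cp_extend f (Poly_Mapping.single h r) = pm_sum (\<lambda>m c. cp_scale c (f m h)) r"
    unfolding cp_extend_eq by (rule pm_sum_single) simp
  also have "\<dots> = F r"
  proof -
    have "F 0 = 0" using assms(2)[of 0 0] by simp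
    thus ?thesis
      by (induction r rule: poly_mapping_induct)
        (simp_all add: pm_sum_single pm_sum_add single_add assms)
  qed
  finally show ?thesis .
qed

locale twisted_group_action = group G for G (structure) +
  fixes \<rho> :: "'a \<Rightarrow> complex ^ 'n ^ 'n::finite" and \<alpha> :: "'a \<Rightarrow> 'a \<Rightarrow> complex"
  assumes representation: "group_representation G \<rho>"
    and cocycle: "two_cocycle G \<alpha>"
    and normalized: "normalized_cocycle G \<alpha>"
begin

abbreviation "A \<equiv> crossed_product G \<rho> \<alpha>"

lemma cocycle_eq:
  "h \<in> carrier G \<Longrightarrow> k \<in> carrier G \<Longrightarrow> l \<in> carrier G \<Longrightarrow>
    \<alpha> h k * \<alpha> (h \<otimes> k) l = \<alpha> h (k \<otimes> l) * \<alpha> k l"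
  using cocycle by (simp add: two_cocycle_def)

lemma cocycle_nonzero: "h \<in> carrier G \<Longrightarrow> k \<in> carrier G \<Longrightarrow> \<alpha> h k \<noteq> 0"
  using cocycle by (simp add: two_cocycle_def)

lemma rho_one: "\<rho> \<one> = mat 1"
  using representation by (simp add: group_representation_def)

lemma rho_mult: "h \<in> carrier G \<Longrightarrow> k \<in> carrier G \<Longrightarrow> \<rho> (h \<otimes> k) = \<rho> h ** \<rho> k"
  using representation by (simp add: group_representation_def)

lemma cp_carrier: "a \<in> carrier A \<longleftrightarrow> Poly_Mapping.keys a \<subseteq> carrier G"
  by (simp add: crossed_product_def)

lemma cp_add: "a \<oplus>\<^bsub>A\<^esub> b = a + b"
  and cp_zero: "\<zero>\<^bsub>A\<^esub> = 0"
  and cp_one: "\<one>\<^bsub>A\<^esub> = Poly_Mapping.single \<one> 1"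
  and cp_smult: "c \<odot>\<^bsub>A\<^esub> a = cp_scale c a"
  by (simp_all add: crossed_product_def)

lemma cp_single_carrier [simp]: "h \<in> carrier G \<Longrightarrow> Poly_Mapping.single h r \<in> carrier A"
  by (simp add: cp_carrier)

lemma cp_induct [consumes 1, case_names single add]:
  assumes "a \<in> carrier A" "\<And>h r. h \<in> carrier G \<Longrightarrow> P (Poly_Mapping.single h r)"
    "\<And>a b. P a \<Longrightarrow> P b \<Longrightarrow> P (a + b)"
  shows "P a"
  using assms(2)[OF one_closed, of 0] assms(1)
  by (intro poly_mapping_induct_on[of a "carrier G" P] assms) (auto simp: cp_carrier)

lemma cp_mult_eq: "a \<otimes>\<^bsub>A\<^esub> b = pm_sum (\<lambda>h r. pm_sum (\<lambda>k r'.
    Poly_Mapping.single (h \<otimes> k) (pconst (\<alpha> h k) * r * sym_act (\<rho> h) r')) b) a"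
  by (simp add: crossed_product_def pm_sum_def)

lemma cp_mult_single:
  "Poly_Mapping.single h r \<otimes>\<^bsub>A\<^esub> Poly_Mapping.single k r' =
    Poly_Mapping.single (h \<otimes> k) (pconst (\<alpha> h k) * r * sym_act (\<rho> h) r')"
  unfolding cp_mult_eq by (simp add: pm_sum_single)

lemma cp_mult_add_right: "a \<otimes>\<^bsub>A\<^esub> (b + b') = a \<otimes>\<^bsub>A\<^esub> b + a \<otimes>\<^bsub>A\<^esub> b'"
  unfolding cp_mult_eq
  by (subst pm_sum_add) (simp_all add: sym_act_add distrib_left single_add pm_sum_add_fun)

lemma cp_mult_add_left: "(a + a') \<otimes>\<^bsub>A\<^esub> b = a \<otimes>\<^bsub>A\<^esub> b + a' \<otimes>\<^bsub>A\<^esub> b"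
  unfolding cp_mult_eq
  by (subst pm_sum_add)
    (simp_all add: distrib_left distrib_right single_add pm_sum_add_fun)

lemma cp_mult_carrier: "a \<in> carrier A \<Longrightarrow> b \<in> carrier A \<Longrightarrow> a \<otimes>\<^bsub>A\<^esub> b \<in> carrier A"
proof (induction a rule: cp_induct)
  case (single h r)
  show ?case using single(2,1)
    by (induction b rule: cp_induct)
      (auto simp: cp_mult_single cp_mult_add_right cp_carrier dest!: subsetD[OF keys_add])
qed (auto simp: cp_mult_add_left cp_carrier dest!: subsetD[OF keys_add])

lemma cp_mult_assoc:
  assumes "a \<in> carrier A" "b \<in> carrier A" "c \<in> carrier A"
  shows "(a \<otimes>\<^bsub>A\<^esub> b) \<otimes>\<^bsub>A\<^esub> c = a \<otimes>\<^bsub>A\<^esub> (b \<otimes>\<^bsub>A\<^esub> c)"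
  using assms(1)
proof (induction a rule: cp_induct)
  case (single h r)
  note h = single
  show ?case using assms(2)
  proof (induction b rule: cp_induct)
    case (single k r')
    note k = single
    show ?case using assms(3)
    proof (induction c rule: cp_induct)
      case (single l r'')
      let ?x = "r * sym_act (\<rho> h) r' * sym_act (\<rho> h) (sym_act (\<rho> k) r'')"
      \<comment> \<open>Both bracketings carry the polynomial \<open>?x\<close>; they differ in
        their scalars, which the cocycle identity equates.\<close>
      have "pconst (\<alpha> h k * \<alpha> (h \<otimes> k) l) * ?x = pconst (\<alpha> h (k \<otimes> l) * \<alpha> k l) * ?x"
        by (simp only: cocycle_eq[OF h k single])
      thus ?case
        using h k single
        by (simp add: cp_mult_single sym_act_mult rho_mult sym_act_compose m_assoc pconst_mult mult_ac)
    qed (simp add: cp_mult_add_right)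
  qed (simp add: cp_mult_add_right cp_mult_add_left)
qed (simp add: cp_mult_add_left)

lemma cp_one_mult:
  assumes "a \<in> carrier A"
  shows "\<one>\<^bsub>A\<^esub> \<otimes>\<^bsub>A\<^esub> a = a" "a \<otimes>\<^bsub>A\<^esub> \<one>\<^bsub>A\<^esub> = a"
  using assms normalized
  by (induction a rule: cp_induct)
    (auto simp: cp_one cp_mult_single cp_mult_add_left cp_mult_add_right rho_one
      normalized_cocycle_def)

lemma cp_scale_carrier: "a \<in> carrier A \<Longrightarrow> cp_scale c a \<in> carrier A"
  using keys_cp_scale[of c a] by (auto simp: cp_carrier)

lemma cp_mult_scale:
  assumes "a \<in> carrier A" "b \<in> carrier A"
  shows "cp_scale c a \<otimes>\<^bsub>A\<^esub> b = cp_scale c (a \<otimes>\<^bsub>A\<^esub> b)"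
    and "a \<otimes>\<^bsub>A\<^esub> cp_scale c b = cp_scale c (a \<otimes>\<^bsub>A\<^esub> b)"
proof -
  have "cp_scale c a \<otimes>\<^bsub>A\<^esub> b = cp_scale c (a \<otimes>\<^bsub>A\<^esub> b) \<and> a \<otimes>\<^bsub>A\<^esub> cp_scale c b = cp_scale c (a \<otimes>\<^bsub>A\<^esub> b)"
    using assms(1)
  proof (induction a rule: cp_induct)
    case (single h r)
    show ?case using assms(2)
      by (induction b rule: cp_induct)
        (auto simp: cp_mult_single cp_mult_add_right cp_scale_add_right sym_act_mult mult_ac)
  qed (auto simp: cp_mult_add_left cp_scale_add_right)
  thus "cp_scale c a \<otimes>\<^bsub>A\<^esub> b = cp_scale c (a \<otimes>\<^bsub>A\<^esub> b)"
    and "a \<otimes>\<^bsub>A\<^esub> cp_scale c b = cp_scale c (a \<otimes>\<^bsub>A\<^esub> b)" by auto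
qed

lemma cp_abelian_group: "abelian_group A"
proof (rule abelian_groupI)
  show "\<exists>y\<in>carrier A. y \<oplus>\<^bsub>A\<^esub> x = \<zero>\<^bsub>A\<^esub>" if "x \<in> carrier A" for x
    using that by (intro bexI[of _ "- x"]) (auto simp: cp_carrier cp_add cp_zero in_keys_iff)
qed (auto simp: cp_carrier cp_add cp_zero algebra_simps dest!: subsetD[OF keys_add])

lemma cp_ring: "ring A"
proof (rule ringI)
  show "Group.monoid A"
    by (rule Group.monoidI) (auto simp: cp_mult_carrier cp_mult_assoc cp_one_mult cp_one[symmetric],
        simp add: cp_one)
qed (auto simp: cp_abelian_group cp_add cp_mult_add_left cp_mult_add_right)

lemma cp_assoc_algebra: "assoc_algebra ring_of_type_algebra A"
proof -
  have "module (ring_of_type_algebra :: complex ring) A"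
    by (rule moduleI[OF cring_from_type_algebra cp_abelian_group])
      (auto simp: cp_smult cp_add ring_of_type_algebra_def cp_scale_add_left
        cp_scale_add_right cp_scale_cp_scale cp_scale_carrier)
  thus ?thesis by (auto simp: assoc_algebra_def cp_ring cp_smult cp_mult_scale)
qed

sublocale cp: additive_algebra A
  by unfold_locales (auto simp: cp_assoc_algebra cp_add cp_zero)

lemma cp_linear_operatorI:
  assumes add: "\<And>a b. T (a + b) = T a + T b"
    and closed: "\<And>h r. h \<in> carrier G \<Longrightarrow> T (Poly_Mapping.single h r) \<in> carrier A"
    and scale: "\<And>h r c. h \<in> carrier G \<Longrightarrow> T (Poly_Mapping.single h (pconst c * r)) =
      cp_scale c (T (Poly_Mapping.single h r))"
  shows "cp.linear_operator T"
proof -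
  have "T a \<in> carrier A" if "a \<in> carrier A" for a
    using that by (induction a rule: cp_induct) (auto simp: add closed)
  moreover have "T (cp_scale c a) = cp_scale c (T a)" if "a \<in> carrier A" for a c
    using that by (induction a rule: cp_induct) (auto simp: add scale cp_scale_add_right)
  ultimately show ?thesis by (auto simp: cp.linear_operator_def cp_smult add)
qed

end

section \<open>The operators on the crossed product\<close>

lemma axis_one_nth: "axis i (1::complex) $ j = (if j = i then 1 else 0)"
  by (simp add: axis_def)

lemma scale_axis_nth: "scale_axis i c $ a $ b = (if a = b then if a = i then c else 1 else 0)"
  by (simp add: scale_axis_def)

lemma scale_axis_commute:
  fixes M :: "complex ^ 'n ^ 'n::finite"
  assumes "\<And>j. j \<noteq> i \<Longrightarrow> M $ i $ j = 0" "\<And>j. j \<noteq> i \<Longrightarrow> M $ j $ i = 0"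
  shows "scale_axis i c ** M = M ** scale_axis i c"
  unfolding vec_eq_iff scale_axis_mult_nth mult_scale_axis_nth using assms by auto

lemma sym_act_pconst_mult: "sym_act M (pconst c * x) = pconst c * sym_act M x"
  by (simp add: sym_act_mult)

text \<open>The relation between q-numbers at \<open>q\<close> and at its inverse, free of negative
  exponents. It transfers vanishing q-factorials to the parameter used for the second
  variable.\<close>

lemma qnum_inverse: "q \<noteq> 0 \<Longrightarrow> qnum (inverse q) n * q ^ n = q * qnum q n"
proof (induction n)
  case (Suc n)
  have "inverse q ^ n * q ^ n = 1"
    using Suc.prems by (simp flip: power_mult_distrib)
  hence "qnum (inverse q) (Suc n) * q ^ Suc n = q * (qnum (inverse q) n * q ^ n) + q"
    by (simp add: qnum_def distrib_left distrib_right mult_ac)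
  also have "\<dots> = q * (q * qnum q n) + q"
    using Suc by simp
  also have "\<dots> = q * qnum q (Suc n)"
    using qnum_add[of q 1 n] by (simp add: qnum_def[of q "Suc 0"] distrib_left)
  finally show ?case .
qed simp

lemma qfact_inverse_eq_0_iff: "q \<noteq> 0 \<Longrightarrow> qfact (inverse q) n = 0 \<longleftrightarrow> qfact q n = 0"
proof -
  assume q: "q \<noteq> 0"
  have "qnum (inverse q) k = 0 \<longleftrightarrow> qnum q k = 0" for k
    using arg_cong[OF qnum_inverse[OF q, of k], of "\<lambda>x. x = 0"] q by simp
  thus ?thesis by (simp add: qfact_def)
qed

text \<open>The hypotheses in matrix form: \<open>axis1\<close> and \<open>axis2\<close> describe
  columns, while \<open>row1\<close> and \<open>row2\<close> keep x_1 and x_2 out of the images of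
  all other basis vectors. Together they let the group commute with both scalings.\<close>

locale q_derivation_data = twisted_group_action G \<rho> \<alpha>
  for G (structure) and \<rho> :: "'a \<Rightarrow> complex ^ 'n ^ 'n::finite" and \<alpha> +
  fixes q :: complex and g :: 'a and i1 i2 :: 'n and s :: "'n mpoly"
  assumes q_nonzero: "q \<noteq> 0"
    and distinct: "i1 \<noteq> i2"
    and g_carrier [simp]: "g \<in> carrier G"
    and g_central: "h \<in> carrier G \<Longrightarrow> g \<otimes> h = h \<otimes> g"
    and axis1: "h \<in> carrier G \<Longrightarrow> \<rho> h *v axis i1 1 = line_char \<rho> i1 h *s axis i1 1"
    and axis2: "h \<in> carrier G \<Longrightarrow> \<rho> h *v axis i2 1 = line_char \<rho> i2 h *s axis i2 1"
    and row1: "h \<in> carrier G \<Longrightarrow> j \<noteq> i1 \<Longrightarrow> \<rho> h $ i1 $ j = 0"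
    and row2: "h \<in> carrier G \<Longrightarrow> j \<noteq> i2 \<Longrightarrow> \<rho> h $ i2 $ j = 0"
    and rho_g: "\<rho> g = scale_axis i1 q ** scale_axis i2 (inverse q)"
    and s_free: "\<forall>m\<in>Poly_Mapping.keys s. Poly_Mapping.lookup m i1 = 0 \<and> Poly_Mapping.lookup m i2 = 0"
    and s_act: "h \<in> carrier G \<Longrightarrow> sym_act (\<rho> h) s =
      pconst (line_char \<rho> i1 h * line_char \<rho> i2 h * \<alpha> g h * inverse (\<alpha> h g)) * s"
begin

abbreviation "\<chi>1 \<equiv> line_char \<rho> i1"
abbreviation "\<chi>2 \<equiv> line_char \<rho> i2"
abbreviation "\<tau> \<equiv> sym_act (scale_axis i1 q)"
abbreviation "d1 \<equiv> qdiff i1 q"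
abbreviation "d2 \<equiv> qdiff i2 (inverse q)"
abbreviation "D1 \<equiv> op_D1 G \<rho> i1 q"
abbreviation "D2 \<equiv> op_D2 G \<rho> \<alpha> i1 i2 q s g"

text \<open>The polynomial part of \<open>D2\<close>: the factor \<open>q^k\<close> for the exponent
  k of x_1 is the effect of \<open>\<tau>\<close>, which leaves multiplication by \<open>s\<close>
  and by the group element g.\<close>

definition theta :: "'n mpoly \<Rightarrow> 'n mpoly" where
  "theta r = \<tau> (d2 r)"

definition sigma :: "('a \<Rightarrow>\<^sub>0 'n mpoly) \<Rightarrow> ('a \<Rightarrow>\<^sub>0 'n mpoly)" where
  "sigma = pm_sum (\<lambda>h r. Poly_Mapping.single h (pconst (\<chi>1 (inv h)) * \<tau> r))"

section \<open>Characters, and the coefficient operators under the group action\<close>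

lemma chi1_entry: "h \<in> carrier G \<Longrightarrow> \<rho> h $ j $ i1 = (if j = i1 then \<chi>1 h else 0)"
  using arg_cong[OF axis1, of h "\<lambda>v. v $ j"] by (simp add: matrix_vector_axis axis_one_nth split: if_splits)

lemma chi2_entry: "h \<in> carrier G \<Longrightarrow> \<rho> h $ j $ i2 = (if j = i2 then \<chi>2 h else 0)"
  using arg_cong[OF axis2, of h "\<lambda>v. v $ j"] by (simp add: matrix_vector_axis axis_one_nth split: if_splits)

lemma chi1_mult:
  assumes "h \<in> carrier G" "k \<in> carrier G"
  shows "\<chi>1 (h \<otimes> k) = \<chi>1 h * \<chi>1 k"
proof -
  have "\<rho> (h \<otimes> k) *v axis i1 1 = \<rho> h *v (\<rho> k *v axis i1 1)"
    using assms by (simp add: rho_mult matrix_vector_mul_assoc)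
  also have "\<dots> = (\<chi>1 h * \<chi>1 k) *s axis i1 1"
    using assms by (simp add: axis1 vector_scalar_commute mult.commute)
  finally have "(\<rho> (h \<otimes> k) *v axis i1 1) $ i1 = ((\<chi>1 h * \<chi>1 k) *s axis i1 1) $ i1"
    by simp
  thus ?thesis using assms by (simp add: matrix_vector_axis chi1_entry)
qed

lemma chi1_inv:
  assumes "h \<in> carrier G"
  shows "\<chi>1 (inv h) * \<chi>1 h = 1"
proof -
  have "\<chi>1 \<one> = 1"
    using chi1_entry[of \<one> i1] by (simp add: rho_one mat_def)
  thus ?thesis using chi1_mult[of "inv h" h] assms by simp
qed

lemma chi1_g: "\<chi>1 g = q"
  using chi1_entry[of g i1] distinct
  by (simp add: rho_g scale_axis_mult_nth scale_axis_nth)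

lemma chi1_inv_mult:
  assumes "h \<in> carrier G" "k \<in> carrier G"
  shows "\<chi>1 (inv (h \<otimes> k)) = \<chi>1 (inv h) * \<chi>1 (inv k)"
  using assms by (simp add: inv_mult_group chi1_mult mult.commute)

lemma chi1_inv_g: "\<chi>1 (inv g) = inverse q"
  using chi1_inv[of g] q_nonzero by (simp add: chi1_g field_simps)

lemma scale_axis_rho:
  assumes "h \<in> carrier G"
  shows "scale_axis i1 c ** \<rho> h = \<rho> h ** scale_axis i1 c"
    "scale_axis i2 c ** \<rho> h = \<rho> h ** scale_axis i2 c"
  using assms by (intro scale_axis_commute; simp add: row1 row2 chi1_entry chi2_entry)+

lemma tau_rho: "h \<in> carrier G \<Longrightarrow> \<tau> (sym_act (\<rho> h) r) = sym_act (\<rho> h) (\<tau> r)"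
  by (simp add: sym_act_compose[symmetric] scale_axis_rho)

lemma d1_rho: "h \<in> carrier G \<Longrightarrow> d1 (sym_act (\<rho> h) r) = pconst (\<chi>1 h) * sym_act (\<rho> h) (d1 r)"
  using qdiff_sym_act[of i1 "\<rho> h" q r] by (simp add: row1 scale_axis_rho chi1_entry)

lemma theta_rho:
  "h \<in> carrier G \<Longrightarrow> theta (sym_act (\<rho> h) r) = pconst (\<chi>2 h) * sym_act (\<rho> h) (theta r)"
  using qdiff_sym_act[of i2 "\<rho> h" "inverse q" r]
  by (simp add: row2 scale_axis_rho chi2_entry theta_def sym_act_pconst_mult tau_rho)

lemma theta_add: "theta (x + y) = theta x + theta y"
  by (simp add: theta_def qdiff_add sym_act_add)

text \<open>The scaling of x_1 from \<open>\<tau>\<close> and the scaling of x_2 from the Leibniz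
  rule of \<open>d2\<close> compose to the action of \<open>g\<close>. This matches the effect of
  moving g past \<open>y\<close> in the crossed product.\<close>

lemma theta_mult: "theta (x * y) = theta x * sym_act (\<rho> g) y + \<tau> x * theta y"
  by (simp add: theta_def qdiff_mult sym_act_add sym_act_mult rho_g sym_act_compose)

lemma theta_pconst_mult: "theta (pconst c * x) = pconst c * theta x"
  by (simp add: theta_def qdiff_pconst_mult sym_act_pconst_mult)

lemma s_constant [simp]: "d1 s = 0" "d2 s = 0" "\<tau> s = s"
  using s_free by (auto intro!: qdiff_free_of sym_act_scale_axis_free_of)

lemma theta_pconst [simp]: "theta (pconst c) = 0"
  by (simp add: theta_def)

lemma theta_s_mult: "theta (s * x) = s * theta x"
proof -
  have "theta s = 0" by (simp add: theta_def)
  thus ?thesis by (simp add: theta_mult)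
qed

text \<open>\<open>d1\<close> and \<open>d2\<close> concern different variables and commute; the
  factor \<open>q\<close> arises from passing \<open>\<tau>\<close>.\<close>

lemma d1_theta: "d1 (theta r) = pconst q * theta (d1 r)"
  using distinct by (simp add: theta_def qdiff_scale_axis_same qdiff_commute[of i1 i2])

lemma d1_tau: "d1 (\<tau> r) = pconst q * \<tau> (d1 r)"
  by (rule qdiff_scale_axis_same)

lemma theta_tau: "theta (\<tau> r) = \<tau> (theta r)"
  using distinct by (simp add: theta_def qdiff_scale_axis_other)

text \<open>Since \<open>\<tau>\<close> commutes with \<open>d2\<close>, powers of
  \<open>theta\<close> factor through powers of \<open>d2\<close>.\<close>

lemma theta_nilpotent:
  assumes "qfact q n = 0"
  shows "(theta ^^ n) r = 0"
proof -
  have "d2 ((\<tau> ^^ k) r) = (\<tau> ^^ k) (d2 r)" for k :: nat and r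
    using distinct by (induction k) (simp_all add: qdiff_scale_axis_other)
  hence "(theta ^^ k) r = (\<tau> ^^ k) ((d2 ^^ k) r)" for k :: nat
    by (induction k) (simp_all add: theta_def)
  moreover have "(d2 ^^ n) r = 0"
    using assms q_nonzero by (intro qdiff_nilpotent) (simp add: qfact_inverse_eq_0_iff)
  moreover have "(\<tau> ^^ k) 0 = 0" for k :: nat
    by (induction k) simp_all
  ultimately show ?thesis by simp
qed

section \<open>The skew derivation rules on the crossed product\<close>

lemma sigma_add: "sigma (a + b) = sigma a + sigma b"
  unfolding sigma_def
  by (intro pm_sum_add) (simp_all add: sym_act_add distrib_left single_add)

lemma D1_add: "D1 (a + b) = D1 a + D1 b"
  and D2_add: "D2 (a + b) = D2 a + D2 b"
  by (simp_all add: op_D1_def op_D2_def cp_extend_add)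

lemma sigma_single:
  "sigma (Poly_Mapping.single h r) = Poly_Mapping.single h (pconst (\<chi>1 (inv h)) * \<tau> r)"
  unfolding sigma_def by (simp add: pm_sum_single)

lemma D1_single:
  "D1 (Poly_Mapping.single h r) = Poly_Mapping.single h (pconst (\<chi>1 (inv h)) * d1 r)"
  unfolding op_D1_def
  by (rule cp_extend_single)
    (simp_all add: qdiff_single pconst_mult_single qdiff_add distrib_left single_add mult_ac)

lemma D2_single:
  "D2 (Poly_Mapping.single h r) = Poly_Mapping.single (g \<otimes> h) (pconst (\<alpha> g h) * theta r * s)"
  unfolding op_D2_def
proof (rule cp_extend_single)
  fix m :: "'n \<Rightarrow>\<^sub>0 nat" and c :: complex
  \<comment> \<open>\<open>d2\<close> leaves the exponent of x_1 alone, so the power of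
    \<open>q\<close> read off before differentiating agrees with \<open>\<tau>\<close> applied
    afterwards.\<close>
  have "Poly_Mapping.lookup (m - Poly_Mapping.single i2 1) i1 = Poly_Mapping.lookup m i1"
    using distinct by (simp add: lookup_minus lookup_single_not_eq)
  hence *: "pconst c * (pconst (q ^ Poly_Mapping.lookup m i1) * d2 (Poly_Mapping.single m 1)) =
      theta (Poly_Mapping.single m c)"
    by (simp add: theta_def qdiff_single sym_act_scale_axis pconst_mult_single mult_ac)
  show "cp_scale c (Poly_Mapping.single g (pconst (q ^ Poly_Mapping.lookup m i1) *
      d2 (Poly_Mapping.single m 1) * s) \<otimes>\<^bsub>A\<^esub> Poly_Mapping.single h 1) =
      Poly_Mapping.single (g \<otimes> h) (pconst (\<alpha> g h) * theta (Poly_Mapping.single m c) * s)"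
    unfolding *[symmetric] by (simp add: cp_mult_single mult_ac)
qed (simp add: theta_add distrib_left distrib_right single_add)

lemma linear_sigma: "cp.linear_operator sigma"
  by (rule cp_linear_operatorI) (simp_all add: sigma_add sigma_single sym_act_mult mult_ac)

lemma linear_D1: "cp.linear_operator D1"
  by (rule cp_linear_operatorI) (simp_all add: D1_add D1_single qdiff_mult mult_ac)

lemma linear_D2: "cp.linear_operator D2"
  by (rule cp_linear_operatorI) (simp_all add: D2_add D2_single theta_mult mult_ac)

lemma D1_mult:
  assumes "a \<in> carrier A" "b \<in> carrier A"
  shows "D1 (a \<otimes>\<^bsub>A\<^esub> b) = D1 a \<otimes>\<^bsub>A\<^esub> sigma b + a \<otimes>\<^bsub>A\<^esub> D1 b"
  using assms(1)
proof (induction a rule: cp_induct)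
  case (single h r)
  note h = single
  show ?case using assms(2)
  proof (induction b rule: cp_induct)
    case (single k r')
    \<comment> \<open>Moving \<open>d1\<close> past the action of \<open>h\<close> produces
      \<open>\<chi>1 h\<close>. It cancels the part of the prefactor that belongs to
      \<open>h\<close> and leaves the one required by \<open>D1\<close> at \<open>k\<close>.\<close>
    have "\<chi>1 (inv (h \<otimes> k)) * \<chi>1 h = \<chi>1 (inv k)"
      using chi1_inv[OF h] h single by (simp add: chi1_inv_mult)
    hence *: "pconst (\<chi>1 (inv (h \<otimes> k))) * (pconst (\<chi>1 h) * x) = pconst (\<chi>1 (inv k)) * x" for x
      by (simp add: pconst_mult[symmetric] mult.assoc[symmetric])
    have "pconst (\<chi>1 (inv (h \<otimes> k))) * d1 (pconst (\<alpha> h k) * r * sym_act (\<rho> h) r') =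
        pconst (\<alpha> h k) * (pconst (\<chi>1 (inv (h \<otimes> k))) * d1 r * \<tau> (sym_act (\<rho> h) r') +
          r * (pconst (\<chi>1 (inv (h \<otimes> k))) * (pconst (\<chi>1 h) * sym_act (\<rho> h) (d1 r'))))"
      using h by (simp add: mult.assoc qdiff_pconst_mult) (simp add: qdiff_mult d1_rho algebra_simps)
    also have "\<dots> = pconst (\<alpha> h k) * (pconst (\<chi>1 (inv h)) * d1 r) *
          sym_act (\<rho> h) (pconst (\<chi>1 (inv k)) * \<tau> r') +
        pconst (\<alpha> h k) * r * sym_act (\<rho> h) (pconst (\<chi>1 (inv k)) * d1 r')"
      unfolding * using h single
      by (simp add: chi1_inv_mult pconst_mult sym_act_mult tau_rho algebra_simps)
    finally show ?case
      by (simp add: cp_mult_single D1_single sigma_single single_add)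
  qed (simp add: cp_mult_add_right D1_add sigma_add add_ac)
qed (simp add: cp_mult_add_left D1_add add_ac)

lemma D2_mult:
  assumes "a \<in> carrier A" "b \<in> carrier A"
  shows "D2 (a \<otimes>\<^bsub>A\<^esub> b) = D2 a \<otimes>\<^bsub>A\<^esub> b + sigma a \<otimes>\<^bsub>A\<^esub> D2 b"
  using assms(1)
proof (induction a rule: cp_induct)
  case (single h r)
  note h = single
  show ?case using assms(2)
  proof (induction b rule: cp_induct)
    case (single k r')
    \<comment> \<open>The cocycle identity for (g, h, k) settles the term in which \<open>a\<close>
      is differentiated.\<close>
    have 1: "\<alpha> g (h \<otimes> k) * \<alpha> h k = \<alpha> (g \<otimes> h) k * \<alpha> g h"
      using cocycle_eq[of g h k] h single by (simp add: mult.commute)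
    \<comment> \<open>The other term needs the identity for (h, g, k), where centrality of
      \<open>g\<close> allows writing \<open>g \<otimes> h\<close> for
      \<open>h \<otimes> g\<close>.\<close>
    have "\<alpha> h (g \<otimes> k) * \<alpha> g k = \<alpha> h g * \<alpha> (g \<otimes> h) k"
      using cocycle_eq[of h g k] h single by (simp add: g_central)
    \<comment> \<open>The bracketed characters of \<open>h\<close> cancel, and the cocycle quotient
      from \<open>s_act\<close> replaces \<alpha>(h, g) by \<alpha>(g, h). What remains is
      \<open>\<chi>2 h\<close>, the factor from moving \<open>theta\<close> past
      \<open>h\<close>.\<close>
    hence "\<alpha> h (g \<otimes> k) * \<alpha> g k * (\<chi>1 (inv h) * \<chi>1 h) * \<chi>2 h * \<alpha> g h * inverse (\<alpha> h g) =
        \<alpha> (g \<otimes> h) k * \<alpha> g h * \<chi>2 h"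
      using cocycle_nonzero[of h g] h by (simp add: chi1_inv)
    hence 2: "\<alpha> h (g \<otimes> k) * \<chi>1 (inv h) * \<alpha> g k * (\<chi>1 h * \<chi>2 h * \<alpha> g h * inverse (\<alpha> h g)) =
        \<alpha> g (h \<otimes> k) * \<alpha> h k * \<chi>2 h"
      unfolding 1 by (simp only: mult_ac)
    have "pconst (\<alpha> g (h \<otimes> k)) * theta (pconst (\<alpha> h k) * r * sym_act (\<rho> h) r') * s =
        pconst (\<alpha> g (h \<otimes> k) * \<alpha> h k) * theta r * sym_act (\<rho> g) (sym_act (\<rho> h) r') * s +
        pconst (\<alpha> g (h \<otimes> k) * \<alpha> h k * \<chi>2 h) * \<tau> r * sym_act (\<rho> h) (theta r') * s"
      using h by (simp add: mult.assoc theta_pconst_mult)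
        (simp add: theta_mult theta_rho pconst_mult algebra_simps)
    also have "pconst (\<alpha> g (h \<otimes> k) * \<alpha> h k) * theta r * sym_act (\<rho> g) (sym_act (\<rho> h) r') * s =
        pconst (\<alpha> (g \<otimes> h) k) * (pconst (\<alpha> g h) * theta r * s) * sym_act (\<rho> (g \<otimes> h)) r'"
      unfolding 1 using h by (simp add: rho_mult sym_act_compose pconst_mult mult_ac)
    also have "pconst (\<alpha> g (h \<otimes> k) * \<alpha> h k * \<chi>2 h) * \<tau> r * sym_act (\<rho> h) (theta r') * s =
        pconst (\<alpha> h (g \<otimes> k)) * (pconst (\<chi>1 (inv h)) * \<tau> r) *
          sym_act (\<rho> h) (pconst (\<alpha> g k) * theta r' * s)"
      unfolding 2[symmetric] using h by (simp add: sym_act_mult s_act pconst_mult mult_ac)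
    finally have *: "pconst (\<alpha> g (h \<otimes> k)) * theta (pconst (\<alpha> h k) * r * sym_act (\<rho> h) r') * s =
        pconst (\<alpha> (g \<otimes> h) k) * (pconst (\<alpha> g h) * theta r * s) * sym_act (\<rho> (g \<otimes> h)) r' +
        pconst (\<alpha> h (g \<otimes> k)) * (pconst (\<chi>1 (inv h)) * \<tau> r) *
          sym_act (\<rho> h) (pconst (\<alpha> g k) * theta r' * s)" .
    have "g \<otimes> (h \<otimes> k) = g \<otimes> h \<otimes> k" "h \<otimes> (g \<otimes> k) = g \<otimes> h \<otimes> k"
      using h single g_central[OF h] by (simp_all add: m_assoc[symmetric])
    thus ?case
      unfolding cp_mult_single D2_single sigma_single by (simp only: * single_add)
  qed (simp add: cp_mult_add_right D2_add add_ac)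
qed (simp add: cp_mult_add_left D2_add sigma_add add_ac)

lemma D1_sigma: "a \<in> carrier A \<Longrightarrow> D1 (sigma a) = cp_scale q (sigma (D1 a))"
  by (induction a rule: cp_induct)
    (simp_all add: D1_add sigma_add cp_scale_add_right D1_single sigma_single qdiff_mult
      sym_act_mult d1_tau mult_ac)

text \<open>Here \<open>theta\<close> and \<open>\<tau>\<close> commute outright; the factor
  \<open>q\<close> is due to \<open>D2\<close> moving the group component from h to g h, which
  changes the character in \<open>sigma\<close> by the inverse of \<open>q\<close>.\<close>

lemma D2_sigma: "a \<in> carrier A \<Longrightarrow> D2 (sigma a) = cp_scale q (sigma (D2 a))"
proof (induction a rule: cp_induct)
  case (single h r)
  have "\<chi>1 (inv h) = q * \<chi>1 (inv (g \<otimes> h))"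
    using single q_nonzero by (simp add: chi1_inv_mult chi1_inv_g)
  thus ?case
    by (simp add: D2_single sigma_single theta_mult theta_tau sym_act_mult pconst_mult mult_ac)
qed (simp_all add: D2_add sigma_add cp_scale_add_right)

text \<open>Two effects cancel: \<open>d1\<close> past \<open>theta\<close> gives \<open>q\<close>,
  and the character at g h instead of h gives the inverse of \<open>q\<close>.\<close>

lemma D1_D2: "a \<in> carrier A \<Longrightarrow> D1 (D2 a) = D2 (D1 a)"
proof (induction a rule: cp_induct)
  case (single h r)
  have *: "\<chi>1 (inv h) = \<chi>1 (inv (g \<otimes> h)) * q"
    using single q_nonzero by (simp add: chi1_inv_mult chi1_inv_g)
  show ?case
    unfolding D2_single D1_single *
    by (simp add: qdiff_mult theta_mult d1_theta pconst_mult mult_ac)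
qed (simp_all add: D2_add D1_add)

lemma D1_one: "D1 \<one>\<^bsub>A\<^esub> = 0" and D2_one: "D2 \<one>\<^bsub>A\<^esub> = 0"
proof -
  have "d1 1 = 0" "theta 1 = 0"
    using qdiff_pconst[of i1 q 1] qdiff_pconst[of i2 "inverse q" 1] by (simp_all add: theta_def)
  thus "D1 \<one>\<^bsub>A\<^esub> = 0" "D2 \<one>\<^bsub>A\<^esub> = 0" by (simp_all add: cp_one D1_single D2_single)
qed

lemma D1_nilpotent:
  assumes "qfact q n = 0" "a \<in> carrier A"
  shows "(D1 ^^ n) a = 0"
  using assms(2)
proof (induction a rule: cp_induct)
  case (single h r)
  have "(D1 ^^ k) (Poly_Mapping.single h r) =
      Poly_Mapping.single h (pconst (\<chi>1 (inv h) ^ k) * (d1 ^^ k) r)" for k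
    by (induction k) (simp_all add: D1_single qdiff_mult pconst_mult mult_ac)
  thus ?case using assms(1) by (simp add: qdiff_nilpotent)
next
  case (add a b)
  have "(D1 ^^ k) (a + b) = (D1 ^^ k) a + (D1 ^^ k) b" for k
    by (induction k) (simp_all add: D1_add)
  thus ?case using add by simp
qed

lemma D2_nilpotent:
  assumes "qfact q n = 0" "a \<in> carrier A"
  shows "(D2 ^^ n) a = 0"
  using assms(2)
proof (induction a rule: cp_induct)
  case (single h r)
  \<comment> \<open>The factor \<open>u\<close> collects powers of \<open>s\<close> and cocycle
    values. These are constants for \<open>theta\<close>, so the k-th power of \<open>D2\<close>
    still contains the k-th power of \<open>theta\<close>.\<close>
  have "\<exists>l u. (D2 ^^ k) (Poly_Mapping.single h r) = Poly_Mapping.single l (u * (theta ^^ k) r) \<and>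
      (\<forall>x. theta (u * x) = u * theta x)" for k
  proof (induction k)
    case 0
    show ?case by (intro exI[of _ h] exI[of _ 1]) simp
  next
    case (Suc k)
    then obtain l u where *: "(D2 ^^ k) (Poly_Mapping.single h r) =
        Poly_Mapping.single l (u * (theta ^^ k) r)" "\<And>x. theta (u * x) = u * theta x" by blast
    show ?case
    proof (intro exI conjI allI)
      show "(D2 ^^ Suc k) (Poly_Mapping.single h r) =
          Poly_Mapping.single (g \<otimes> l) (pconst (\<alpha> g l) * (s * u) * (theta ^^ Suc k) r)"
        by (simp add: * D2_single, simp add: mult_ac)
      show "theta (pconst (\<alpha> g l) * (s * u) * x) = pconst (\<alpha> g l) * (s * u) * theta x" for x
        by (simp add: mult.assoc theta_pconst_mult theta_s_mult *(2))
    qed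
  qed
  from this[of n] show ?case using assms(1) by (auto simp: theta_nilpotent)
next
  case (add a b)
  have "(D2 ^^ k) (a + b) = (D2 ^^ k) a + (D2 ^^ k) b" for k
    by (induction k) (simp_all add: D2_add)
  thus ?case using add by simp
qed

theorem formal_deformation_crossed_product: "formal_deformation A (qexp_star A q D1 D2)"
proof -
  interpret skew_derivation_pair A q sigma D1 D2
    by unfold_locales
      (auto simp: linear_sigma linear_D1 linear_D2 D1_mult D2_mult D1_sigma D2_sigma D1_D2
        D1_one D2_one D1_nilpotent D2_nilpotent cp_smult)
  show ?thesis by (rule formal_deformation_qexp_star)
qed

end

section \<open>The degenerate case, and the passage to matrix entries\<close>

context twisted_group_action
begin

text \<open>For \<open>s = 0\<close> the deformation is trivial, but \<open>D1\<close> need not be a skew derivation if \<open>q = 1\<close>.\<close>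

lemma formal_deformation_trivial:
  "formal_deformation A (qexp_star A q (op_D1 G \<rho> i1 q) (op_D2 G \<rho> \<alpha> i1 i2 q 0 g))"
proof -
  have mult_0: "a \<otimes>\<^bsub>A\<^esub> 0 = 0" "0 \<otimes>\<^bsub>A\<^esub> a = 0" for a
    by (simp_all add: cp_mult_eq)
  have D2: "op_D2 G \<rho> \<alpha> i1 i2 q 0 g = (\<lambda>_. 0)"
    by (rule ext) (simp add: op_D2_def cp_extend_def mult_0)
  \<comment> \<open>With \<open>D2\<close> zero, all terms of positive order vanish whatever
    \<open>D1\<close> is. Hence \<open>D1\<close> may be replaced by zero, which satisfies the skew
    derivation rules.\<close>
  have star: "qexp_star A q (op_D1 G \<rho> i1 q) (\<lambda>_. 0) = qexp_star A q (\<lambda>_. 0) (\<lambda>_. 0)"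
  proof (intro ext)
    fix a b i
    show "qexp_star A q (op_D1 G \<rho> i1 q) (\<lambda>_. 0) a b i = qexp_star A q (\<lambda>_. 0) (\<lambda>_. 0) a b i"
      by (cases i) (simp_all add: qexp_star_def mult_0)
  qed
  \<comment> \<open>The power 0 would be the identity, but \<open>qfact q 0 = 1\<close> excludes
    it.\<close>
  have nilpotent: "((\<lambda>_. 0 :: 'a \<Rightarrow>\<^sub>0 'n mpoly) ^^ n) a = 0" if "qfact q n = 0" for n and a :: "'a \<Rightarrow>\<^sub>0 'n mpoly"
    using that by (cases n) auto
  interpret skew_derivation_pair A q "\<lambda>a. a" "\<lambda>_. 0" "\<lambda>_. 0"
    by unfold_locales (auto simp: cp.linear_operator_def mult_0 nilpotent)
  show ?thesis unfolding D2 star by (rule formal_deformation_qexp_star)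
qed

end

lemma axis_span_scale:
  assumes "preserves_subspace G \<rho> (vec.span {axis i 1})" "h \<in> carrier G"
  shows "\<rho> h *v axis i 1 = line_char \<rho> i h *s axis i 1"
proof -
  have "\<rho> h *v axis i 1 \<in> vec.span {axis i 1}"
    using assms by (auto simp: preserves_subspace_def intro: vec.span_base)
  then obtain c where c: "\<rho> h *v axis i 1 = c *s axis i 1"
    by (auto simp: vec.span_singleton)
  have "c' = c" if "c' *s axis i 1 = c *s axis i (1::complex)" for c'
    using arg_cong[OF that, of "\<lambda>v. v $ i"] by (simp add: axis_one_nth)
  hence "line_char \<rho> i h = c"
    unfolding line_char_def c by (intro the_equality) auto
  thus ?thesis using c by simp
qed

lemma span_axes_nth:
  fixes v :: "complex ^ 'n::finite"
  assumes "v \<in> vec.span {axis j 1 | j. P j}" "\<not> P i"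
  shows "v $ i = 0"
  using assms(1)
proof (induction rule: vec.span_induct_alt)
  case (step c x y)
  thus ?case using assms(2) by (auto simp: axis_one_nth split: if_splits)
qed simp

theorem corollary4p8:
  fixes G :: "('g, 'm) monoid_scheme"
    and \<rho> :: "'g \<Rightarrow> complex ^ 'n ^ 'n::finite"
    and \<alpha> :: "'g \<Rightarrow> 'g \<Rightarrow> complex"
    and q :: complex and g :: 'g and i1 i2 :: 'n and s :: "'n mpoly"
  assumes "group G"
    and "group_representation G \<rho>"
    and "two_cocycle G \<alpha>" and "normalized_cocycle G \<alpha>"
    and "q \<noteq> 0"
    and "i1 \<noteq> i2"
    and "g \<in> carrier G" and "\<forall>h\<in>carrier G. g \<otimes>\<^bsub>G\<^esub> h = h \<otimes>\<^bsub>G\<^esub> g"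
    and "\<rho> g *v axis i1 1 = q *s axis i1 1"
    and "\<rho> g *v axis i2 1 = inverse q *s axis i2 1"
    and "\<forall>j. j \<noteq> i1 \<and> j \<noteq> i2 \<longrightarrow> \<rho> g *v axis j 1 = axis j 1"
    and "preserves_subspace G \<rho> (vec.span {axis i1 1})"
    and "preserves_subspace G \<rho> (vec.span {axis i2 1})"
    and "\<forall>m\<in>Poly_Mapping.keys s. Poly_Mapping.lookup m i1 = 0 \<and> Poly_Mapping.lookup m i2 = 0"
    and "\<forall>h\<in>carrier G. sym_act (\<rho> h) s =
           pconst (line_char \<rho> i1 h * line_char \<rho> i2 h * \<alpha> g h * inverse (\<alpha> h g)) * s"
    (* Automatic if q is not 1; needed for associativity if q = 1 and s is nonzero. *)
    and "q = 1 \<and> s \<noteq> 0 \<longrightarrow>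
           preserves_subspace G \<rho> (vec.span {axis j 1 | j. j \<noteq> i1 \<and> j \<noteq> i2})"
  shows "formal_deformation (crossed_product G \<rho> \<alpha>)
           (qexp_star (crossed_product G \<rho> \<alpha>) q (op_D1 G \<rho> i1 q) (op_D2 G \<rho> \<alpha> i1 i2 q s g))"
proof -
  interpret group G by fact
  interpret twisted_group_action G \<rho> \<alpha>
    by unfold_locales (use assms in auto)
  show ?thesis
  proof (cases "s = 0")
    case True
    thus ?thesis by (simp add: formal_deformation_trivial)
  next
    case False
    have axis: "\<rho> h *v axis i 1 = line_char \<rho> i h *s axis i 1"
      if "h \<in> carrier G" "i = i1 \<or> i = i2" for h i
      using assms(12,13) that by (auto intro: axis_span_scale)
    have rho_g: "\<rho> g = scale_axis i1 q ** scale_axis i2 (inverse q)"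
      unfolding vec_eq_iff
    proof (intro allI)
      fix a b
      have "\<rho> g *v axis b 1 = (if b = i1 then q else if b = i2 then inverse q else 1) *s axis b 1"
        using assms(9-11) by auto
      from arg_cong[OF this, of "\<lambda>v. v $ a"]
      show "\<rho> g $ a $ b = (scale_axis i1 q ** scale_axis i2 (inverse q)) $ a $ b"
        using \<open>i1 \<noteq> i2\<close> by (auto simp: matrix_vector_axis axis_one_nth scale_axis_mult_nth scale_axis_nth)
    qed
    \<comment> \<open>Columns of x_1 and x_2 are settled by the preserved lines. For the remaining
      columns, \<open>q = 1\<close> uses the preserved complement, and other values of
      \<open>q\<close> use centrality of \<open>g\<close>.\<close>
    have row: "\<rho> h $ i $ j = 0" if h: "h \<in> carrier G" and i: "i = i1 \<or> i = i2" and "j \<noteq> i" for h i j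
    proof (cases "j = i1 \<or> j = i2")
      case True
      show ?thesis
        using arg_cong[OF axis[OF h True], of "\<lambda>v. v $ i"] \<open>j \<noteq> i\<close>
        by (simp add: matrix_vector_axis axis_one_nth)
    next
      case j: False
      show ?thesis
      proof (cases "q = 1")
        case True
        have "\<rho> h *v axis j 1 \<in> vec.span {axis j 1 | j. j \<noteq> i1 \<and> j \<noteq> i2}"
          using assms(16) True False h j
          unfolding preserves_subspace_def by (blast intro: vec.span_base)
        from span_axes_nth[OF this, of i] i show ?thesis by (auto simp: matrix_vector_axis)
      next
        case q: False
        \<comment> \<open>Comparing entries in the commutation relation equates the entry with its
          multiple by an eigenvalue \<open>q\<close> or \<open>inverse q\<close> of
          \<open>\<rho> g\<close>. As this eigenvalue differs from 1, the entry is 0.\<close>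
        have "\<rho> g ** \<rho> h = \<rho> h ** \<rho> g"
          using assms(7,8) h by (simp flip: rho_mult)
        hence "(scale_axis i1 q ** (scale_axis i2 (inverse q) ** \<rho> h)) $ i $ j =
            ((\<rho> h ** scale_axis i1 q) ** scale_axis i2 (inverse q)) $ i $ j"
          by (simp add: rho_g matrix_mul_assoc)
        hence "(if i = i1 then q else inverse q) * \<rho> h $ i $ j = \<rho> h $ i $ j"
          using i j \<open>i1 \<noteq> i2\<close> by (auto simp: scale_axis_mult_nth mult_scale_axis_nth)
        thus ?thesis using q by (auto split: if_splits)
      qed
    qed
    interpret q_derivation_data G \<rho> \<alpha> q g i1 i2 s
      by unfold_locales (use assms axis row rho_g in auto)
    show ?thesis by (rule formal_deformation_crossed_product)
  qed
qed

end
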